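(* Let $f\colon(\mathbb{R}^2,0)\to(\mathbb{R}^3,0)$ be a frontal with a $5/2$-cuspidal edge at $0$, with $\kappa_t(0)\neq0$ and principal curvatures $\kappa_1,\kappa_2$ nowhere zero. Then the mean curvature $H^{C_j}$ $(j=1,2)$ of the focal surface $C_j$ (with respect to the unit normal $\boldsymbol{e}_j$) is given at $0$ by $$H^{C_j}=-\frac{\kappa_j\bigl(\kappa_s(\kappa_t^2+(\kappa_\nu-\kappa_j)^2)+\kappa_t'(\kappa_\nu-\kappa_j)-\kappa_t\kappa_\nu'\bigr)}{2\bigl(\kappa_t^2+(\kappa_\nu-\kappa_j)^2\bigr)^{3/2}}.$$
   Context: All maps are $C^\infty$. A map germ $f\colon(\mathbb{R}^2,0)\to(\mathbb{R}^3,0)$ is a frontal if there is a smooth $\nu\colon(\mathbb{R}^2,0)\to\mathbb{S}^2$ (a unit normal vector field) with $\langle df_q(X),\nu(q)\rangle=0$ for all $q$ and $X\in T_q\mathbb{R}^2$. $S(f)=\{q: \operatorname{rank}df_q<2\}$. A null vector field along $S(f)$ is a nowhere vanishing vector field $\eta$ with $df(\eta)=0$ on $S(f)$. $f$ has a $5/2$-cuspidal edge at $0$ if its germ is $\mathcal{A}$-equivalent (equal up to diffeomorphism germs of source and target) to $(u,v)\mapsto(u,v^2,v^5)$ at the origin. Adapted coordinates: around a $5/2$-cuspidal edge there are coordinates $(u,v)$ with $S(f)=\{v=0\}$, $\partial_v$ a null vector field, and $\{f_u,f_{vv},\nu\}$ orthonormal along the $u$-axis; fix such coordinates. Then $f_v=vh$,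 $\nu_v=v\nu_1$ with $h,\nu_1$ smooth (a $5/2$-cuspidal edge is a so-called pure-frontal singular point, which guarantees $\nu_v(u,0)=0$). Put $\tilde E=\langle f_u,f_u\rangle$, $\tilde F=\langle f_u,h\rangle$, $\tilde G=\langle h,h\rangle$, $\tilde L=-\langle f_u,\nu_u\rangle$, $\tilde M=-\langle h,\nu_u\rangle$, $\tilde N_1=-\langle h,\nu_1\rangle$. The Gaussian and mean curvatures of $f$ extend smoothly as $K=\frac{\tilde L\tilde N_1-\tilde M^2}{\tilde E\tilde G-\tilde F^2}$, $H=\frac{\tilde E\tilde N_1-2\tilde F\tilde M+\tilde G\tilde L}{2(\tilde E\tilde G-\tilde F^2)}$, and the principal curvatures are $\kappa_1=H+\sqrt{H^2-K}$, $\kappa_2=H-\sqrt{H^2-K}$ (distinct and smooth near $0$ if $\kappa_t(0)\ne0$). Along the $u$-axis, the singular curvature, limiting normal curvature and cuspidal torsion are $\kappa_s(u)=\langle f_{uu},h\rangle(u,0)$, $\kappa_\nu(u)=\tilde L(u,0)$, $\kappa_t(u)=\tilde M(u,0)$; primes denote $d/du$. The focal surface associated to $\kappa_j$ is $C_j=f+\rho_j\nu$ with $\rho_j=1/\kappa_j$; under the hypotheses of the claim it is regular at $0$, with unit normal $\boldsymbol{e}_j=\boldsymbol{x}_j/|\boldsymbol{x}_j|$, $\boldsymbol{x}_j=-(\tilde M-\kappa_j\tilde F)f_u+(\tilde L-\kappa_j\tilde E)h$. Its mean curvature is $H^{C_j}=\frac{E'N'-2F'M'+G'L'}{2(E'G'-F'^2)}$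 where $E'=\langle (C_j)_u,(C_j)_u\rangle$, $F'=\langle (C_j)_u,(C_j)_v\rangle$, $G'=\langle (C_j)_v,(C_j)_v\rangle$, $L'=-\langle (C_j)_u,(\boldsymbol{e}_j)_u\rangle$, $M'=-\langle (C_j)_v,(\boldsymbol{e}_j)_u\rangle$, $N'=-\langle (C_j)_v,(\boldsymbol{e}_j)_v\rangle$. *)

theory Defs
  imports "HOL-Analysis.Analysis"
begin

text \<open>Germs at the origin are represented by total functions of which only the values near
  \<open>0\<close> matter.  The source plane is \<^typ>\<open>real \<times> real\<close>, with coordinates
  \<open>(u, v)\<close>.\<close>

section \<open>Smooth germs and \<open>\<A>\<close>-equivalence\<close>

fun Ck_on :: "nat \<Rightarrow> 'a::real_normed_vector set \<Rightarrow> ('a \<Rightarrow> 'b::real_normed_vector) \<Rightarrow> bool" where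
  "Ck_on 0 U f \<longleftrightarrow> continuous_on U f"
| "Ck_on (Suc k) U f \<longleftrightarrow> (\<forall>q\<in>U. f differentiable (at q)) \<and>
     (\<forall>X. Ck_on k U (\<lambda>q. frechet_derivative f (at q) X))"

text \<open>Meant for open sets only, since the derivatives are taken in the ambient space.\<close>

definition smooth_on :: "'a::euclidean_space set \<Rightarrow> ('a \<Rightarrow> 'b::euclidean_space) \<Rightarrow> bool" where
  "smooth_on U f \<longleftrightarrow> (\<forall>k. Ck_on k U f)"

definition smooth_germ :: "('a::euclidean_space \<Rightarrow> 'b::euclidean_space) \<Rightarrow> bool" where
  "smooth_germ f \<longleftrightarrow> (\<exists>U. open U \<and> 0 \<in> U \<and> smooth_on U f)"

definition diffeo_germ :: "('a::euclidean_space \<Rightarrow> 'a) \<Rightarrow> bool" where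
  "diffeo_germ \<phi> \<longleftrightarrow> \<phi> 0 = 0 \<and>
     (\<exists>U V \<psi>. open U \<and> 0 \<in> U \<and> open V \<and> homeomorphism U V \<phi> \<psi> \<and>
        smooth_on U \<phi> \<and> smooth_on V \<psi>)"

definition A_equivalent ::
    "('a::euclidean_space \<Rightarrow> 'b::euclidean_space) \<Rightarrow> ('a \<Rightarrow> 'b) \<Rightarrow> bool" where
  "A_equivalent f g \<longleftrightarrow> (\<exists>\<phi> \<Phi>. diffeo_germ \<phi> \<and> diffeo_germ \<Phi> \<and>
     (\<forall>\<^sub>F q in nhds 0. \<Phi> (f q) = g (\<phi> q)))"

definition cuspidal_edge_5_2 :: "(real \<times> real \<Rightarrow> real^3) \<Rightarrow> bool" where
  "cuspidal_edge_5_2 f \<longleftrightarrow> smooth_germ f \<and> f 0 = 0 \<and>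
     A_equivalent f (\<lambda>(u, v). vector [u, v^2, v^5])"

section \<open>Frontals and adapted coordinates\<close>

text \<open>\<open>f\<close> is a frontal germ \<open>(\<real>\<^sup>2, 0) \<rightarrow> (\<real>\<^sup>3, 0)\<close> with unit normal vector field \<open>\<nu>\<close>.\<close>

definition frontal_with_normal ::
    "(real \<times> real \<Rightarrow> real^3) \<Rightarrow> (real \<times> real \<Rightarrow> real^3) \<Rightarrow> bool" where
  "frontal_with_normal f \<nu> \<longleftrightarrow> smooth_germ f \<and> f 0 = 0 \<and> smooth_germ \<nu> \<and>
     (\<forall>\<^sub>F q in nhds 0. norm (\<nu> q) = 1 \<and> (\<forall>X. frechet_derivative f (at q) X \<bullet> \<nu> q = 0))"

definition singular_set :: "(real \<times> real \<Rightarrow> real^3) \<Rightarrow> (real \<times> real) set" where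
  "singular_set f = {q. dim (range (frechet_derivative f (at q))) < 2}"

definition Du :: "(real \<times> real \<Rightarrow> 'a::real_normed_vector) \<Rightarrow> real \<times> real \<Rightarrow> 'a" where
  "Du f q = frechet_derivative f (at q) (1, 0)"

definition Dv :: "(real \<times> real \<Rightarrow> 'a::real_normed_vector) \<Rightarrow> real \<times> real \<Rightarrow> 'a" where
  "Dv f q = frechet_derivative f (at q) (0, 1)"

text \<open>\<open>f\<close> with unit normal \<open>\<nu>\<close>, as a map of its source coordinates \<open>(u, v)\<close>, is in adapted
  form.\<close>

definition adapted ::
    "(real \<times> real \<Rightarrow> real^3) \<Rightarrow> (real \<times> real \<Rightarrow> real^3) \<Rightarrow> bool" where
  "adapted f \<nu> \<longleftrightarrow>
     (\<forall>\<^sub>F q in nhds 0. q \<in> singular_set f \<longleftrightarrow> snd q = 0) \<and>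
     (\<forall>\<^sub>F q in nhds 0. q \<in> singular_set f \<longrightarrow> Dv f q = 0) \<and>
     (\<forall>\<^sub>F u in nhds 0.
        norm (Du f (u, 0)) = 1 \<and> norm (Dv (Dv f) (u, 0)) = 1 \<and> norm (\<nu> (u, 0)) = 1 \<and>
        Du f (u, 0) \<bullet> Dv (Dv f) (u, 0) = 0 \<and>
        Du f (u, 0) \<bullet> \<nu> (u, 0) = 0 \<and>
        Dv (Dv f) (u, 0) \<bullet> \<nu> (u, 0) = 0)"

text \<open>In all definitions below \<open>f\<close> and \<open>\<nu>\<close> are meant to be in adapted form.  If \<open>X\<close> is smooth
  and vanishes on the \<open>u\<close>-axis, then \<open>quot_v X\<close> is the unique continuous \<open>Y\<close> with
  \<open>X = v Y\<close>; on the axis its value is \<open>X\<^sub>v\<close>.\<close>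

definition quot_v :: "(real \<times> real \<Rightarrow> real^3) \<Rightarrow> real \<times> real \<Rightarrow> real^3" where
  "quot_v X q = (if snd q = 0 then Dv X q else (1 / snd q) *\<^sub>R X q)"

definition h_of :: "(real \<times> real \<Rightarrow> real^3) \<Rightarrow> real \<times> real \<Rightarrow> real^3" where
  "h_of f = quot_v (Dv f)"

definition nu1_of :: "(real \<times> real \<Rightarrow> real^3) \<Rightarrow> real \<times> real \<Rightarrow> real^3" where
  "nu1_of \<nu> = quot_v (Dv \<nu>)"

section \<open>Fundamental forms and curvatures of the frontal\<close>

definition tE :: "(real \<times> real \<Rightarrow> real^3) \<Rightarrow> real \<times> real \<Rightarrow> real" where
  "tE f q = Du f q \<bullet> Du f q"

definition tF :: "(real \<times> real \<Rightarrow> real^3) \<Rightarrow> real \<times> real \<Rightarrow> real" where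
  "tF f q = Du f q \<bullet> h_of f q"

definition tG :: "(real \<times> real \<Rightarrow> real^3) \<Rightarrow> real \<times> real \<Rightarrow> real" where
  "tG f q = h_of f q \<bullet> h_of f q"

definition tL ::
    "(real \<times> real \<Rightarrow> real^3) \<Rightarrow> (real \<times> real \<Rightarrow> real^3) \<Rightarrow> real \<times> real \<Rightarrow> real" where
  "tL f \<nu> q = - (Du f q \<bullet> Du \<nu> q)"

definition tM ::
    "(real \<times> real \<Rightarrow> real^3) \<Rightarrow> (real \<times> real \<Rightarrow> real^3) \<Rightarrow> real \<times> real \<Rightarrow> real" where
  "tM f \<nu> q = - (h_of f q \<bullet> Du \<nu> q)"

definition tN1 ::
    "(real \<times> real \<Rightarrow> real^3) \<Rightarrow> (real \<times> real \<Rightarrow> real^3) \<Rightarrow> real \<times> real \<Rightarrow> real" where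
  "tN1 f \<nu> q = - (h_of f q \<bullet> nu1_of \<nu> q)"

definition gauss_curvature ::
    "(real \<times> real \<Rightarrow> real^3) \<Rightarrow> (real \<times> real \<Rightarrow> real^3) \<Rightarrow> real \<times> real \<Rightarrow> real" where
  "gauss_curvature f \<nu> q =
     (tL f \<nu> q * tN1 f \<nu> q - (tM f \<nu> q)^2) / (tE f q * tG f q - (tF f q)^2)"

definition mean_curvature ::
    "(real \<times> real \<Rightarrow> real^3) \<Rightarrow> (real \<times> real \<Rightarrow> real^3) \<Rightarrow> real \<times> real \<Rightarrow> real" where
  "mean_curvature f \<nu> q =
     (tE f q * tN1 f \<nu> q - 2 * tF f q * tM f \<nu> q + tG f q * tL f \<nu> q)
       / (2 * (tE f q * tG f q - (tF f q)^2))"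

definition kappa1 ::
    "(real \<times> real \<Rightarrow> real^3) \<Rightarrow> (real \<times> real \<Rightarrow> real^3) \<Rightarrow> real \<times> real \<Rightarrow> real" where
  "kappa1 f \<nu> q =
     mean_curvature f \<nu> q + sqrt ((mean_curvature f \<nu> q)^2 - gauss_curvature f \<nu> q)"

definition kappa2 ::
    "(real \<times> real \<Rightarrow> real^3) \<Rightarrow> (real \<times> real \<Rightarrow> real^3) \<Rightarrow> real \<times> real \<Rightarrow> real" where
  "kappa2 f \<nu> q =
     mean_curvature f \<nu> q - sqrt ((mean_curvature f \<nu> q)^2 - gauss_curvature f \<nu> q)"

definition singular_curvature :: "(real \<times> real \<Rightarrow> real^3) \<Rightarrow> real \<Rightarrow> real" where
  "singular_curvature f u = Du (Du f) (u, 0) \<bullet> h_of f (u, 0)"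

definition limiting_normal_curvature ::
    "(real \<times> real \<Rightarrow> real^3) \<Rightarrow> (real \<times> real \<Rightarrow> real^3) \<Rightarrow> real \<Rightarrow> real" where
  "limiting_normal_curvature f \<nu> u = tL f \<nu> (u, 0)"

definition cuspidal_torsion ::
    "(real \<times> real \<Rightarrow> real^3) \<Rightarrow> (real \<times> real \<Rightarrow> real^3) \<Rightarrow> real \<Rightarrow> real" where
  "cuspidal_torsion f \<nu> u = tM f \<nu> (u, 0)"

section \<open>Focal surfaces\<close>

text \<open>The argument \<open>\<kappa>\<close> is one of the two principal curvature functions.\<close>

definition focal_surface ::
    "(real \<times> real \<Rightarrow> real^3) \<Rightarrow> (real \<times> real \<Rightarrow> real^3) \<Rightarrow> (real \<times> real \<Rightarrow> real) \<Rightarrow>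
     real \<times> real \<Rightarrow> real^3" where
  "focal_surface f \<nu> \<kappa> q = f q + (1 / \<kappa> q) *\<^sub>R \<nu> q"

definition focal_direction ::
    "(real \<times> real \<Rightarrow> real^3) \<Rightarrow> (real \<times> real \<Rightarrow> real^3) \<Rightarrow> (real \<times> real \<Rightarrow> real) \<Rightarrow>
     real \<times> real \<Rightarrow> real^3" where
  "focal_direction f \<nu> \<kappa> q =
     - (tM f \<nu> q - \<kappa> q * tF f q) *\<^sub>R Du f q + (tL f \<nu> q - \<kappa> q * tE f q) *\<^sub>R h_of f q"

definition focal_normal ::
    "(real \<times> real \<Rightarrow> real^3) \<Rightarrow> (real \<times> real \<Rightarrow> real^3) \<Rightarrow> (real \<times> real \<Rightarrow> real) \<Rightarrow>
     real \<times> real \<Rightarrow> real^3" where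
  "focal_normal f \<nu> \<kappa> q =
     (1 / norm (focal_direction f \<nu> \<kappa> q)) *\<^sub>R focal_direction f \<nu> \<kappa> q"

text \<open>Mean curvature of a regular parametrised surface \<open>C\<close> with respect to the unit normal
  \<open>e\<close>.\<close>

definition surface_mean_curvature ::
    "(real \<times> real \<Rightarrow> real^3) \<Rightarrow> (real \<times> real \<Rightarrow> real^3) \<Rightarrow> real \<times> real \<Rightarrow> real" where
  "surface_mean_curvature C e q =
     (let E = Du C q \<bullet> Du C q; F = Du C q \<bullet> Dv C q; G = Dv C q \<bullet> Dv C q;
          L = - (Du C q \<bullet> Du e q); M = - (Dv C q \<bullet> Du e q); N = - (Dv C q \<bullet> Dv e q)
      in (E * N - 2 * F * M + G * L) / (2 * (E * G - F^2)))"

end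

theory Submission
  imports Defs
begin

text \<open>
  Why the formula holds.  Let \<open>a = g\<^sub>u\<close>, \<open>b = h\<close>, \<open>c = n\<close> be the orthonormal frame at the
  origin, let \<open>L, M, N, E, F, G\<close> be the modified fundamental forms and let
  \<open>\<rho> = 1 / \<kappa>\<close>.  Both \<open>g\<^sub>v\<close> and \<open>n\<^sub>v\<close> vanish along the edge, so the focal surface
  \<open>C = g + \<rho> n\<close> satisfies \<open>C\<^sub>v = \<rho>\<^sub>v c\<close> and \<open>C\<^sub>u = (1 - \<rho> L) a - \<rho> M b + \<rho>\<^sub>u c\<close> at
  the origin.  Its unit normal \<open>e\<close> is orthogonal to \<open>n\<close> everywhere, which gives
  \<open>\<langle>c, e\<^sub>v\<rangle> = 0\<close> and \<open>\<langle>c, e\<^sub>u\<rangle> = - \<langle>e, n\<^sub>u\<rangle>\<close>; the remaining entry \<open>\<langle>C\<^sub>u, e\<^sub>u\<rangle>\<close>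
  only involves \<open>u\<close>-derivatives along the edge, where \<open>\<langle>g\<^sub>u\<^sub>u, h\<rangle>\<close>, \<open>M\<close> and \<open>L\<close> are the
  singular curvature, the cuspidal torsion and the limiting normal curvature.  In the quotient that
  defines the mean curvature every factor \<open>\<rho>\<^sub>v\<close> cancels, and so do the terms containing
  \<open>\<kappa>\<^sub>u\<close> (\<open>focal_mean_curvature_formula\<close>, \<open>focal_mean_curvature\<close>).

  The cancellation requires \<open>\<rho>\<^sub>v \<noteq> 0\<close>, that is \<open>\<kappa>\<^sub>v \<noteq> 0\<close>: this is the regularity of the
  focal surface, and it has to be derived.  Differentiating
  \<open>(L - \<kappa> E) (N - \<kappa> G) = (M - \<kappa> F)\<^sup>2\<close> in \<open>v\<close> gives
  \<open>\<kappa>\<^sub>v ((L - \<kappa>) + (N - \<kappa>)) = (L - \<kappa>) (N\<^sub>v - N G\<^sub>v - 2 M F\<^sub>v)\<close> at the origin, and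
  \<open>L \<noteq> \<kappa>\<close> because \<open>M \<noteq> 0\<close> (\<open>kappa_v_nonzero\<close>).  Hence the number
  \<open>N\<^sub>v - N G\<^sub>v - 2 M F\<^sub>v\<close> must not vanish.

  Both this and the vanishing of \<open>n\<^sub>v\<close> on the edge come from the normal form
  \<open>(u, v\<^sup>2, v\<^sup>5)\<close>.  If \<open>\<psi>\<close> is the third component of the diffeomorphism of the target, then
  \<open>\<psi> \<circ> g = y\<^sup>5\<close> for a function \<open>y\<close> that vanishes on the edge to exactly first order.  Let
  \<open>P\<close> be the gradient of \<open>\<psi>\<close> along \<open>g\<close>.  Then \<open>v \<langle>P, h\<rangle> = (y\<^sup>5)\<^sub>v\<close>, so
  \<open>\<langle>P, h\<rangle> = v\<^sup>3 \<beta>\<close> with \<open>\<beta> \<noteq> 0\<close> on the edge, while \<open>P\<close> is a nonzero multiple of \<open>n\<close>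
  there.  Differentiating \<open>\<langle>P, h\<rangle> = v\<^sup>3 \<beta>\<close> once yields \<open>\<langle>n, h\<^sub>v\<rangle> = 0\<close>, hence
  \<open>n\<^sub>v = 0\<close> (\<open>is_pure\<close>); differentiating it three times yields
  \<open>2 \<langle>P, n\<rangle> (N\<^sub>v - N G\<^sub>v - 2 M F\<^sub>v) = 6 \<beta>\<close> (\<open>nondegenerate_axis\<close>).

  Two analytic tools are built first: the closure of smooth maps under products and
  composition, and Hadamard's lemma, which makes the quotients \<open>h\<close> and \<open>\<nu>\<^sub>1\<close> smooth across
  the edge and also gives the symmetry of mixed partial derivatives.
\<close>

section \<open>Calculus of continuously differentiable maps\<close>

lemma frechet_derivative_cong:
  assumes "open U" "q \<in> U" "\<And>p. p \<in> U \<Longrightarrow> f p = g p"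
  shows "frechet_derivative f (at q) = frechet_derivative g (at q)"
proof -
  have "(f has_derivative D) (at q) \<longleftrightarrow> (g has_derivative D) (at q)" for D
    using assms has_derivative_transform_within_open[of f D q UNIV U g]
      has_derivative_transform_within_open[of g D q UNIV U f] by auto
  then show ?thesis unfolding frechet_derivative_def by simp
qed

lemma differentiable_cong_open:
  assumes "open U" "q \<in> U" "\<And>p. p \<in> U \<Longrightarrow> f p = g p" "f differentiable (at q)"
  shows "g differentiable (at q)"
  using assms has_derivative_transform_within_open[of f _ q UNIV U g]
  unfolding differentiable_def by blast

lemma Ck_on_cong:
  assumes "open U" "\<And>q. q \<in> U \<Longrightarrow> f q = g q" "Ck_on k U f"
  shows "Ck_on k U g"
  using assms(2,3)
proof (induction k arbitrary: f g)
  case 0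
  then show ?case by (simp cong: continuous_on_cong)
next
  case (Suc k)
  have "Ck_on k U (\<lambda>q. frechet_derivative g (at q) X)" for X
  proof (rule Suc.IH)
    show "frechet_derivative f (at q) X = frechet_derivative g (at q) X" if "q \<in> U" for q
      using frechet_derivative_cong[OF assms(1) that Suc.prems(1)] by simp
    show "Ck_on k U (\<lambda>q. frechet_derivative f (at q) X)" using Suc.prems(2) by simp
  qed
  moreover have "g differentiable (at q)" if "q \<in> U" for q
    using differentiable_cong_open[OF assms(1) that Suc.prems(1)] Suc.prems(2) that by auto
  ultimately show ?case by simp
qed

lemma Ck_on_SucI:
  assumes "open U" "\<And>q. q \<in> U \<Longrightarrow> (f has_derivative D q) (at q)"
    "\<And>X. Ck_on k U (\<lambda>q. D q X)"
  shows "Ck_on (Suc k) U f"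
proof -
  have D: "frechet_derivative f (at q) = D q" if "q \<in> U" for q
    using frechet_derivative_at[OF assms(2)[OF that]] by simp
  have "Ck_on k U (\<lambda>q. frechet_derivative f (at q) X)" for X
    by (rule Ck_on_cong[OF assms(1) _ assms(3)[of X]]) (simp add: D)
  then show ?thesis using assms(2) by (auto simp: differentiable_def)
qed

lemma Ck_on_Suc_imp: "Ck_on (Suc k) U f \<Longrightarrow> Ck_on k U f"
proof (induction k arbitrary: f)
  case 0
  then show ?case
    by (auto intro!: continuous_at_imp_continuous_on differentiable_imp_continuous_within)
next
  case (Suc k)
  then show ?case by (metis Ck_on.simps(2))
qed

lemma Ck_on_mono: "j \<le> k \<Longrightarrow> Ck_on k U f \<Longrightarrow> Ck_on j U f"
  by (induction k rule: dec_induct) (auto simp del: Ck_on.simps dest: Ck_on_Suc_imp)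

lemma Ck_on_subset: "Ck_on k U f \<Longrightarrow> V \<subseteq> U \<Longrightarrow> Ck_on k V f"
  by (induction k arbitrary: f) (auto intro: continuous_on_subset)

lemma Ck_on_const: "open U \<Longrightarrow> Ck_on k U (\<lambda>_. c)"
proof (induction k arbitrary: c)
  case (Suc k)
  show ?case by (rule Ck_on_SucI[OF Suc.prems, where D = "\<lambda>_ _. 0"]) (auto intro: Suc)
qed auto

lemma Ck_on_has_derivative:
  "Ck_on (Suc k) U f \<Longrightarrow> q \<in> U \<Longrightarrow> (f has_derivative frechet_derivative f (at q)) (at q)"
  by (simp add: frechet_derivative_works)

lemma Ck_on_add:
  assumes "open U" "Ck_on k U f" "Ck_on k U g"
  shows "Ck_on k U (\<lambda>q. f q + g q)"
  using assms(2,3)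
proof (induction k arbitrary: f g)
  case (Suc k)
  show ?case
  proof (rule Ck_on_SucI[OF assms(1) has_derivative_add])
    show "Ck_on k U (\<lambda>q. frechet_derivative f (at q) X + frechet_derivative g (at q) X)" for X
      using Suc.prems by (intro Suc.IH) auto
  qed (rule Ck_on_has_derivative Suc.prems | assumption)+
qed (auto intro: continuous_on_add)

lemma Ck_on_sum:
  assumes "open U" "finite A" "\<And>i. i \<in> A \<Longrightarrow> Ck_on k U (f i)"
  shows "Ck_on k U (\<lambda>q. \<Sum>i\<in>A. f i q)"
  using assms(2,3)
proof (induction A rule: finite_induct)
  case empty
  then show ?case by (simp add: Ck_on_const assms(1))
next
  case (insert x F)
  then show ?case by (simp add: Ck_on_add assms(1))
qed

lemma Ck_on_bilinear:
  assumes B: "bounded_bilinear B" and "open U" "Ck_on k U f" "Ck_on k U g"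
  shows "Ck_on k U (\<lambda>q. B (f q) (g q))"
  using assms(3,4)
proof (induction k arbitrary: f g)
  case 0
  then show ?case by (simp add: bounded_bilinear.continuous_on[OF B])
next
  case (Suc k)
  show ?case
  proof (rule Ck_on_SucI[OF \<open>open U\<close> bounded_bilinear.FDERIV[OF B]])
    show "Ck_on k U (\<lambda>q. B (f q) (frechet_derivative g (at q) X)
        + B (frechet_derivative f (at q) X) (g q))" for X
      using Suc.prems Ck_on_Suc_imp[OF Suc.prems(1)] Ck_on_Suc_imp[OF Suc.prems(2)]
      by (intro Ck_on_add[OF \<open>open U\<close>] Suc.IH) auto
  qed (use Suc.prems in \<open>auto intro: Ck_on_has_derivative\<close>)
qed

lemma Ck_on_bounded_linear:
  assumes L: "bounded_linear L" and "open U" "Ck_on k U f"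
  shows "Ck_on k U (\<lambda>q. L (f q))"
  using assms(3)
proof (induction k arbitrary: f)
  case 0
  then show ?case by (simp add: bounded_linear.continuous_on[OF L])
next
  case (Suc k)
  show ?case
    by (rule Ck_on_SucI[OF \<open>open U\<close> bounded_linear.has_derivative[OF L]])
      (use Suc in \<open>auto intro: Ck_on_has_derivative\<close>)
qed

lemma linear_euclidean_expansion:
  fixes L :: "'a::euclidean_space \<Rightarrow> 'b::real_normed_vector"
  assumes "linear L"
  shows "L x = (\<Sum>b\<in>Basis. (x \<bullet> b) *\<^sub>R L b)"
proof -
  have "L x = L (\<Sum>b\<in>Basis. (x \<bullet> b) *\<^sub>R b)" by (simp add: euclidean_representation)
  also have "\<dots> = (\<Sum>b\<in>Basis. (x \<bullet> b) *\<^sub>R L b)"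
    by (simp only: linear_sum[OF assms] linear_scale[OF assms])
  finally show ?thesis .
qed

text \<open>The outer derivative is expanded over the standard basis, so that the chain rule becomes a sum of
  products of scalar functions with compositions of one order less; the induction then only has to
  deal with products.\<close>

lemma Ck_on_compose:
  fixes \<phi> :: "'c::real_normed_vector \<Rightarrow> 'a::euclidean_space"
    and f :: "'a \<Rightarrow> 'b::real_normed_vector"
  assumes "open U" "open V" "\<phi> ` U \<subseteq> V" "Ck_on k V f" "Ck_on k U \<phi>"
  shows "Ck_on k U (\<lambda>q. f (\<phi> q))"
  using assms(4,5)
proof (induction k arbitrary: f)
  case 0
  then show ?case using continuous_on_compose2[OF _ _ assms(3)] by auto
next
  case (Suc k)
  have f': "(f has_derivative frechet_derivative f (at (\<phi> q))) (at (\<phi> q))" if "q \<in> U" for q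
    using Suc.prems(1) assms(3) that by (intro Ck_on_has_derivative) auto
  show ?case
  proof (rule Ck_on_SucI[OF \<open>open U\<close>])
    fix q assume q: "q \<in> U"
    have "frechet_derivative f (at (\<phi> q)) (frechet_derivative \<phi> (at q) X) =
        (\<Sum>b\<in>Basis. (frechet_derivative \<phi> (at q) X \<bullet> b) *\<^sub>R frechet_derivative f (at (\<phi> q)) b)" for X
      by (rule linear_euclidean_expansion, rule has_derivative_linear, rule f'[OF q])
    then show "((\<lambda>q. f (\<phi> q)) has_derivative (\<lambda>X. \<Sum>b\<in>Basis.
        (frechet_derivative \<phi> (at q) X \<bullet> b) *\<^sub>R frechet_derivative f (at (\<phi> q)) b)) (at q)"
      using has_derivative_compose[OF Ck_on_has_derivative[OF Suc.prems(2) q] f'[OF q]]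
      by simp
  next
    fix X
    have 1: "Ck_on k U (\<lambda>q. frechet_derivative \<phi> (at q) X)" using Suc.prems(2) by simp
    have 2: "Ck_on k U (\<lambda>q. frechet_derivative f (at (\<phi> q)) b)" for b
      using Suc.prems Ck_on_Suc_imp by (intro Suc.IH) auto
    show "Ck_on k U (\<lambda>q. \<Sum>b\<in>Basis.
        (frechet_derivative \<phi> (at q) X \<bullet> b) *\<^sub>R frechet_derivative f (at (\<phi> q)) b)"
      by (intro Ck_on_sum Ck_on_bilinear[OF bounded_bilinear_scaleR] finite_Basis assms(1) 2
          Ck_on_bounded_linear[OF bounded_linear_inner_left] 1)
  qed
qed

lemma smooth_on_const [intro]: "open U \<Longrightarrow> smooth_on U (\<lambda>_. c)"
  by (simp add: smooth_on_def Ck_on_const)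

lemma smooth_on_bilinear:
  "bounded_bilinear B \<Longrightarrow> open U \<Longrightarrow> smooth_on U f \<Longrightarrow> smooth_on U g
    \<Longrightarrow> smooth_on U (\<lambda>q. B (f q) (g q))"
  by (simp add: smooth_on_def Ck_on_bilinear)

lemmas smooth_on_inner = smooth_on_bilinear[OF bounded_bilinear_inner]
lemmas smooth_on_scaleR = smooth_on_bilinear[OF bounded_bilinear_scaleR]
lemmas smooth_on_mult = smooth_on_bilinear[OF bounded_bilinear_mult]

lemma smooth_on_bounded_linear:
  "bounded_linear L \<Longrightarrow> open U \<Longrightarrow> smooth_on U f \<Longrightarrow> smooth_on U (\<lambda>q. L (f q))"
  by (simp add: smooth_on_def Ck_on_bounded_linear)

lemma smooth_on_add:
  "open U \<Longrightarrow> smooth_on U f \<Longrightarrow> smooth_on U g \<Longrightarrow> smooth_on U (\<lambda>q. f q + g q)"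
  by (simp add: smooth_on_def Ck_on_add)

lemma smooth_on_sum:
  "open U \<Longrightarrow> finite A \<Longrightarrow> (\<And>i. i \<in> A \<Longrightarrow> smooth_on U (f i))
    \<Longrightarrow> smooth_on U (\<lambda>q. \<Sum>i\<in>A. f i q)"
  by (simp add: smooth_on_def Ck_on_sum)

lemma smooth_on_power:
  fixes f :: "'a::euclidean_space \<Rightarrow> real"
  assumes "open U" "smooth_on U f"
  shows "smooth_on U (\<lambda>q. f q ^ k)"
  by (induction k) (use assms in \<open>auto intro!: smooth_on_mult\<close>)

lemma smooth_on_compose:
  "open U \<Longrightarrow> open V \<Longrightarrow> \<phi> ` U \<subseteq> V \<Longrightarrow> smooth_on V f \<Longrightarrow> smooth_on U \<phi>
    \<Longrightarrow> smooth_on U (\<lambda>q. f (\<phi> q))"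
  by (simp add: smooth_on_def Ck_on_compose)

lemma smooth_on_cong:
  "open U \<Longrightarrow> (\<And>q. q \<in> U \<Longrightarrow> f q = g q) \<Longrightarrow> smooth_on U f \<Longrightarrow> smooth_on U g"
  using Ck_on_cong unfolding smooth_on_def by metis

lemma smooth_on_subset: "smooth_on U f \<Longrightarrow> V \<subseteq> U \<Longrightarrow> smooth_on V f"
  using Ck_on_subset unfolding smooth_on_def by blast

lemma smooth_on_frechet_derivative:
  "smooth_on U f \<Longrightarrow> smooth_on U (\<lambda>q. frechet_derivative f (at q) X)"
  unfolding smooth_on_def by (metis Ck_on.simps(2))

lemma smooth_on_imp_differentiable: "smooth_on U f \<Longrightarrow> q \<in> U \<Longrightarrow> f differentiable (at q)"
  unfolding smooth_on_def by (metis Ck_on.simps(2))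

lemma smooth_on_imp_continuous_on: "smooth_on U f \<Longrightarrow> continuous_on U f"
  unfolding smooth_on_def by (metis Ck_on.simps(1))

lemma smooth_on_id: "open U \<Longrightarrow> smooth_on U (\<lambda>q. q)"
proof -
  assume U: "open U"
  have "Ck_on k U (\<lambda>q. q)" for k
  proof (cases k)
    case (Suc m)
    then show ?thesis
      using Ck_on_SucI[OF U has_derivative_ident] Ck_on_const[OF U] by auto
  qed (simp add: continuous_on_id)
  then show ?thesis by (simp add: smooth_on_def)
qed

lemma smooth_on_snd: "open U \<Longrightarrow> smooth_on U snd"
  using smooth_on_bounded_linear[OF bounded_linear_snd _ smooth_on_id] by blast

section \<open>Hadamard's lemma in the transverse variable\<close>

text \<open>The weights make the family closed under differentiation: a \<open>v\<close>-derivative raises \<open>j\<close> by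
  one.  For \<open>j = 0\<close> this is the mean of \<open>G\<close> over the segment from the axis to \<open>q\<close> along the
  \<open>v\<close>-direction.\<close>

definition vavg :: "nat \<Rightarrow> (real \<times> real \<Rightarrow> 'a::euclidean_space) \<Rightarrow> real \<times> real \<Rightarrow> 'a" where
  "vavg j G q = integral {0..1} (\<lambda>t. t ^ j *\<^sub>R G (fst q, t * snd q))"

text \<open>Balls around the origin are used as neighbourhoods because they contain, with each point, the
  segment in the \<open>v\<close>-direction down to the axis.\<close>

lemma ball_shrink_snd:
  assumes "q \<in> ball (0::real \<times> real) r" "0 \<le> t" "t \<le> 1"
  shows "(fst q, t * snd q) \<in> ball 0 r"
proof -
  have "(t * snd q)\<^sup>2 \<le> (snd q)\<^sup>2"
    using assms(2,3) mult_left_le_one_le[of "(snd q)\<^sup>2" "t\<^sup>2"]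
    by (simp add: power_mult_distrib power_le_one)
  then have "norm (fst q, t * snd q) \<le> norm q"
    by (simp add: norm_prod_def)
  then show ?thesis using assms(1) by simp
qed

lemma continuous_on_shrink_snd:
  assumes "continuous_on (ball (0::real \<times> real) r) G"
  shows "continuous_on (ball 0 r \<times> {0..1}) (\<lambda>(q, t). t ^ j *\<^sub>R (G (fst q, t * snd q) :: 'a::real_normed_vector))"
proof -
  have "continuous_on (ball 0 r \<times> {0..1::real}) (\<lambda>p. G (fst (fst p), snd p * snd (fst p)))"
    by (rule continuous_on_compose2[OF assms])
      (auto intro!: continuous_intros simp del: mem_ball dest: ball_shrink_snd)
  then show ?thesis unfolding split_beta by (intro continuous_intros)
qed

lemma continuous_on_vavg:
  assumes "continuous_on (ball 0 r) G"
  shows "continuous_on (ball 0 r) (vavg j G)"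
  using integral_continuous_on_param[of "ball 0 r" 0 1 "\<lambda>q t. t ^ j *\<^sub>R G (fst q, t * snd q)"]
    continuous_on_shrink_snd[OF assms, of j]
  unfolding vavg_def by auto

lemma vavg_integrable:
  fixes G :: "real \<times> real \<Rightarrow> 'a::euclidean_space"
  assumes "continuous_on (ball 0 r) G" "q \<in> ball 0 r"
  shows "(\<lambda>t. t ^ j *\<^sub>R G (fst q, t * snd q)) integrable_on {0..1}"
proof (rule integrable_continuous_interval)
  show "continuous_on {0..1} (\<lambda>t. t ^ j *\<^sub>R G (fst q, t * snd q))"
    using continuous_on_compose2[OF continuous_on_shrink_snd[OF assms(1), of j],
        of "{0..1}" "\<lambda>t. (q, t)"] continuous_on_Pair[OF continuous_on_const continuous_on_id]
      assms(2) by fastforce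
qed

lemma frechet_derivative_prod:
  assumes "(f::real \<times> real \<Rightarrow> 'a::real_normed_vector) differentiable (at q)"
  shows "frechet_derivative f (at q) X = fst X *\<^sub>R Du f q + snd X *\<^sub>R Dv f q"
proof -
  interpret linear "frechet_derivative f (at q)"
    using assms frechet_derivative_works has_derivative_linear by blast
  have "X = fst X *\<^sub>R (1, 0) + snd X *\<^sub>R (0, 1)" by (simp add: prod_eq_iff)
  then have "frechet_derivative f (at q) X =
      frechet_derivative f (at q) (fst X *\<^sub>R (1, 0) + snd X *\<^sub>R (0, 1))" by metis
  then show ?thesis by (simp add: add scale Du_def Dv_def del: scaleR_Pair)
qed

text \<open>Differentiation under the integral sign; the integrand is recast as a function with values in
  the bounded linear maps, whose joint continuity can be checked on the two basis vectors.\<close>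

lemma has_derivative_vavg:
  fixes G :: "real \<times> real \<Rightarrow> 'a::euclidean_space"
  assumes G: "Ck_on (Suc 0) (ball 0 r) G" and q0: "q0 \<in> ball 0 r"
  shows "(vavg j G has_derivative
    (\<lambda>X. fst X *\<^sub>R vavg j (Du G) q0 + snd X *\<^sub>R vavg (Suc j) (Dv G) q0)) (at q0)"
proof -
  define D where "D q t = (\<lambda>X::real\<times>real. t ^ j *\<^sub>R (fst X *\<^sub>R Du G (fst q, t * snd q)
      + (t * snd X) *\<^sub>R Dv G (fst q, t * snd q)))" for q t
  have lin: "bounded_linear (D q t)" for q t
    unfolding D_def by (intro bounded_linear_intros)
  have cont: "continuous_on (ball 0 r) (Du G)" "continuous_on (ball 0 r) (Dv G)"
    using G unfolding Du_def Dv_def by simp_all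
  have cG: "continuous_on (ball 0 r) G" using Ck_on_Suc_imp[OF G] by simp
  have der: "((\<lambda>q. t ^ j *\<^sub>R G (fst q, t * snd q)) has_derivative blinfun_apply (Blinfun (D q t)))
      (at q within ball 0 r)" if "q \<in> ball 0 r" "t \<in> cbox 0 1" for q t
  proof -
    let ?p = "(fst q, t * snd q)"
    have p: "?p \<in> ball 0 r" using ball_shrink_snd that by simp
    have 1: "((\<lambda>q. (fst q, t * snd q)) has_derivative (\<lambda>X. (fst X, t * snd X))) (at q)"
      by (auto intro!: derivative_eq_intros)
    have "((\<lambda>q. t ^ j *\<^sub>R G (fst q, t * snd q)) has_derivative
        (\<lambda>X. t ^ j *\<^sub>R frechet_derivative G (at ?p) (fst X, t * snd X))) (at q)"
      by (intro has_derivative_scaleR_right has_derivative_compose[OF 1] Ck_on_has_derivative[OF G p])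
    moreover have "G differentiable (at ?p)" using G p by simp
    then have "frechet_derivative G (at ?p) X = fst X *\<^sub>R Du G ?p + snd X *\<^sub>R Dv G ?p" for X
      by (rule frechet_derivative_prod)
    ultimately have "((\<lambda>q. t ^ j *\<^sub>R G (fst q, t * snd q)) has_derivative D q t) (at q)"
      by (simp add: D_def)
    then show ?thesis
      unfolding bounded_linear_Blinfun_apply[OF lin] by (rule has_derivative_at_withinI)
  qed
  have cD: "continuous_on (ball 0 r \<times> {0..1}) (\<lambda>(q, t). Blinfun (D q t))"
  proof (rule continuous_on_blinfun_componentwise)
    fix i :: "real \<times> real"
    have "(\<lambda>x. blinfun_apply (case x of (q, t) \<Rightarrow> Blinfun (D q t)) i) =
       (\<lambda>x. fst i *\<^sub>R (case x of (q, t) \<Rightarrow> t ^ j *\<^sub>R Du G (fst q, t * snd q))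
         + snd i *\<^sub>R (case x of (q, t) \<Rightarrow> t ^ Suc j *\<^sub>R Dv G (fst q, t * snd q)))"
      unfolding split_beta bounded_linear_Blinfun_apply[OF lin]
      by (simp add: D_def algebra_simps)
    then show "continuous_on (ball 0 r \<times> {0..1}) (\<lambda>x. blinfun_apply (case x of (q, t) \<Rightarrow> Blinfun (D q t)) i)"
      using continuous_on_shrink_snd[OF cont(1), of j] continuous_on_shrink_snd[OF cont(2), of "Suc j"]
      by (simp only:) (intro continuous_on_add continuous_on_scaleR continuous_on_const)
  qed
  have 1: "((\<lambda>q. integral (cbox 0 1) (\<lambda>t. t ^ j *\<^sub>R G (fst q, t * snd q))) has_derivative
      integral (cbox 0 1) (\<lambda>t. Blinfun (D q0 t))) (at q0 within ball 0 r)"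
    by (rule leibniz_rule[OF der]) (use q0 cD vavg_integrable[OF cG] in auto)
  have 2: "blinfun_apply (integral (cbox 0 1) (\<lambda>t. Blinfun (D q0 t)))
      = (\<lambda>X. fst X *\<^sub>R vavg j (Du G) q0 + snd X *\<^sub>R vavg (Suc j) (Dv G) q0)"
  proof
    fix X
    have "(\<lambda>t. Blinfun (D q0 t)) integrable_on cbox 0 1"
      using continuous_on_compose2[OF cD, of "cbox 0 1" "\<lambda>t. (q0, t)"] q0
        continuous_on_Pair[OF continuous_on_const continuous_on_id]
      by (intro integrable_continuous) fastforce
    then have "blinfun_apply (integral (cbox 0 1) (\<lambda>t. Blinfun (D q0 t))) X
        = integral {0..1} (\<lambda>t. D q0 t X)"
      by (simp add: blinfun_apply_integral bounded_linear_Blinfun_apply[OF lin])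
    also have "\<dots> = integral {0..1} (\<lambda>t. fst X *\<^sub>R (t ^ j *\<^sub>R Du G (fst q0, t * snd q0))
        + snd X *\<^sub>R (t ^ Suc j *\<^sub>R Dv G (fst q0, t * snd q0)))"
      by (simp add: D_def algebra_simps)
    also have "\<dots> = fst X *\<^sub>R vavg j (Du G) q0 + snd X *\<^sub>R vavg (Suc j) (Dv G) q0"
      unfolding vavg_def
      by (subst integral_add; (intro integrable_cmul vavg_integrable[OF _ q0] cont)?)
        (simp only: integral_cmul)
    finally show "blinfun_apply (integral (cbox 0 1) (\<lambda>t. Blinfun (D q0 t))) X
      = fst X *\<^sub>R vavg j (Du G) q0 + snd X *\<^sub>R vavg (Suc j) (Dv G) q0" .
  qed
  have "((\<lambda>q. integral (cbox 0 1) (\<lambda>t. t ^ j *\<^sub>R G (fst q, t * snd q))) has_derivative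
      (\<lambda>X. fst X *\<^sub>R vavg j (Du G) q0 + snd X *\<^sub>R vavg (Suc j) (Dv G) q0)) (at q0)"
    using 1 unfolding 2 at_within_open[OF q0 open_ball] .
  then show ?thesis unfolding vavg_def[abs_def] by simp
qed

lemma Ck_on_vavg:
  assumes "Ck_on k (ball 0 r) G"
  shows "Ck_on k (ball 0 r) (vavg j G)"
  using assms
proof (induction k arbitrary: G j)
  case 0
  then show ?case by (simp add: continuous_on_vavg)
next
  case (Suc k)
  have 1: "Ck_on (Suc 0) (ball 0 r) G"
    using Ck_on_mono[OF _ Suc.prems, of "Suc 0"] by simp
  show ?case
  proof (rule Ck_on_SucI[OF open_ball has_derivative_vavg[OF 1]])
    show "Ck_on k (ball 0 r) (\<lambda>q. fst X *\<^sub>R vavg j (Du G) q + snd X *\<^sub>R vavg (Suc j) (Dv G) q)" for X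
      by (intro Ck_on_add open_ball Ck_on_bounded_linear[OF bounded_linear_scaleR_right] Suc.IH)
        (use Suc.prems in \<open>simp_all add: Du_def[abs_def] Dv_def[abs_def]\<close>)
  qed
qed

section \<open>Partial derivatives\<close>

lemma smooth_on_vavg: "smooth_on (ball 0 r) G \<Longrightarrow> smooth_on (ball 0 r) (vavg j G)"
  by (simp add: smooth_on_def Ck_on_vavg)

lemma smooth_on_Du: "smooth_on U f \<Longrightarrow> smooth_on U (Du f)"
  and smooth_on_Dv: "smooth_on U f \<Longrightarrow> smooth_on U (Dv f)"
  unfolding Du_def[abs_def] Dv_def[abs_def] by (rule smooth_on_frechet_derivative; assumption)+

lemma has_derivative_Du: "(f has_derivative D) (at q) \<Longrightarrow> Du f q = D (1, 0)"
  and has_derivative_Dv: "(f has_derivative D) (at q) \<Longrightarrow> Dv f q = D (0, 1)"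
  unfolding Du_def Dv_def using frechet_derivative_at by metis+

lemma has_derivative_Du_Dv:
  assumes "f differentiable (at q)"
  shows "(f has_derivative (\<lambda>X. fst X *\<^sub>R Du f q + snd X *\<^sub>R Dv f q)) (at q)"
proof -
  have "frechet_derivative f (at q) = (\<lambda>X. fst X *\<^sub>R Du f q + snd X *\<^sub>R Dv f q)"
    using frechet_derivative_prod[OF assms] by blast
  then show ?thesis using assms by (simp add: frechet_derivative_works)
qed

lemma
  assumes f: "f differentiable (at q)" and g: "g differentiable (at q)"
  shows Du_add: "Du (\<lambda>q. f q + g q) q = Du f q + Du g q"
    and Dv_add: "Dv (\<lambda>q. f q + g q) q = Dv f q + Dv g q"
    and Du_diff: "Du (\<lambda>q. f q - g q) q = Du f q - Du g q"
    and Dv_diff: "Dv (\<lambda>q. f q - g q) q = Dv f q - Dv g q"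
  using has_derivative_add[OF has_derivative_Du_Dv[OF f] has_derivative_Du_Dv[OF g]]
    has_derivative_diff[OF has_derivative_Du_Dv[OF f] has_derivative_Du_Dv[OF g]]
  by (simp_all add: has_derivative_Du has_derivative_Dv)

lemma
  assumes B: "bounded_bilinear B" and f: "f differentiable (at q)" and g: "g differentiable (at q)"
  shows Du_bilinear: "Du (\<lambda>q. B (f q) (g q)) q = B (f q) (Du g q) + B (Du f q) (g q)"
    and Dv_bilinear: "Dv (\<lambda>q. B (f q) (g q)) q = B (f q) (Dv g q) + B (Dv f q) (g q)"
  using bounded_bilinear.FDERIV[OF B has_derivative_Du_Dv[OF f] has_derivative_Du_Dv[OF g]]
  by (simp_all add: has_derivative_Du has_derivative_Dv)

lemmas Du_inner = Du_bilinear[OF bounded_bilinear_inner]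
  and Dv_inner = Dv_bilinear[OF bounded_bilinear_inner]
  and Du_scaleR = Du_bilinear[OF bounded_bilinear_scaleR]
  and Dv_scaleR = Dv_bilinear[OF bounded_bilinear_scaleR]
  and Du_mult = Du_bilinear[OF bounded_bilinear_mult]
  and Dv_mult = Dv_bilinear[OF bounded_bilinear_mult]

lemma Du_const [simp]: "Du (\<lambda>_. c) q = 0" and Dv_const [simp]: "Dv (\<lambda>_. c) q = 0"
  by (simp_all add: has_derivative_Du[OF has_derivative_const] has_derivative_Dv[OF has_derivative_const])

lemma
  assumes "bounded_linear L" "f differentiable (at q)"
  shows Du_bounded_linear: "Du (\<lambda>q. L (f q)) q = L (Du f q)"
    and Dv_bounded_linear: "Dv (\<lambda>q. L (f q)) q = L (Dv f q)"
  using bounded_linear.has_derivative[OF assms(1) has_derivative_Du_Dv[OF assms(2)]]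
  by (simp_all add: has_derivative_Du has_derivative_Dv)

lemma
  shows Du_snd: "Du (snd :: real \<times> real \<Rightarrow> real) q = 0"
    and Dv_snd: "Dv (snd :: real \<times> real \<Rightarrow> real) q = 1"
  using has_derivative_Du[OF bounded_linear_imp_has_derivative[OF bounded_linear_snd]]
    has_derivative_Dv[OF bounded_linear_imp_has_derivative[OF bounded_linear_snd]]
  by simp_all

lemma differentiable_snd: "(snd :: real \<times> real \<Rightarrow> real) differentiable (at q)"
  using bounded_linear_imp_has_derivative[OF bounded_linear_snd] by (auto simp: differentiable_def)

lemma
  assumes "f differentiable (at q)"
  shows Du_snd_scaleR: "Du (\<lambda>q. snd q *\<^sub>R f q) q = snd q *\<^sub>R Du f q"
    and Dv_snd_scaleR: "Dv (\<lambda>q. snd q *\<^sub>R f q) q = f q + snd q *\<^sub>R Dv f q"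
  using assms by (simp_all add: Du_scaleR Dv_scaleR differentiable_snd Du_snd Dv_snd)

lemma
  assumes "open U" "q \<in> U" "\<And>p. p \<in> U \<Longrightarrow> f p = g p"
  shows Du_cong: "Du f q = Du g q" and Dv_cong: "Dv f q = Dv g q"
  unfolding Du_def Dv_def using frechet_derivative_cong[OF assms] by auto

lemma has_vector_derivative_Du:
  assumes "f differentiable (at (u, v))"
  shows "((\<lambda>t. f (t, v)) has_vector_derivative Du f (u, v)) (at u)"
proof -
  have "((\<lambda>t::real. (t, v)) has_derivative (\<lambda>t. (t, 0))) (at u)"
    by (auto intro!: derivative_eq_intros)
  from has_derivative_compose[OF this has_derivative_Du_Dv[OF assms]]
  show ?thesis by (simp add: has_vector_derivative_def)
qed

lemma deriv_axis:
  assumes "f differentiable (at (u, 0))"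
  shows "deriv (\<lambda>t. f (t, 0)) u = (Du f (u, 0) :: real)"
  using has_vector_derivative_Du[OF assms]
  by (intro DERIV_imp_deriv) (simp add: has_real_derivative_iff_has_vector_derivative)

lemma axis_in_ball [simp]: "(u, 0) \<in> ball (0::real \<times> real) r \<longleftrightarrow> \<bar>u\<bar> < r"
  by (simp add: mem_ball_0 del: mem_ball)

lemma abs_fst_less: "q \<in> ball (0::real \<times> real) r \<Longrightarrow> \<bar>fst q\<bar> < r"
  using ball_shrink_snd[of q r 0] by (simp del: mem_ball)

text \<open>An identity that holds only along the axis may still be differentiated along it.\<close>

lemma Du_axis_cong:
  assumes f: "f differentiable (at (u, 0))" and g: "g differentiable (at (u, 0))"
    and "\<bar>u\<bar> < r" and eq: "\<And>t. \<bar>t\<bar> < r \<Longrightarrow> f (t, 0) = g (t, 0)"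
  shows "Du f (u, 0) = Du g (u, 0)"
proof -
  have "((\<lambda>t. g (t, 0)) has_vector_derivative Du f (u, 0)) (at u)"
    by (rule has_vector_derivative_transform_within_open[OF has_vector_derivative_Du[OF f],
          where S = "{-r<..<r}"]) (use assms(3) eq in \<open>auto simp: abs_less_iff\<close>)
  then show ?thesis
    by (rule vector_derivative_unique_at[OF _ has_vector_derivative_Du[OF g]])
qed

text \<open>On the axis itself division by \<open>v\<close> is impossible, but there the \<open>v\<close>-derivative of
  \<open>v a\<close> equals \<open>a\<close>.\<close>

lemma axis_cancel:
  fixes a b :: "real \<times> real \<Rightarrow> 'a::euclidean_space"
  assumes "smooth_on (ball 0 r) a" "smooth_on (ball 0 r) b" "q \<in> ball 0 r"
    and eq: "\<And>p. p \<in> ball 0 r \<Longrightarrow> snd p *\<^sub>R a p = snd p *\<^sub>R b p"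
  shows "a q = b q"
proof (cases "snd q = 0")
  case True
  have "Dv (\<lambda>p. snd p *\<^sub>R a p) q = Dv (\<lambda>p. snd p *\<^sub>R b p) q"
    by (rule Dv_cong[OF open_ball assms(3) eq])
  then show ?thesis
    using assms True by (simp add: Dv_snd_scaleR smooth_on_imp_differentiable)
qed (use eq[OF assms(3)] in simp)

lemma vavg_axis: "vavg 0 G (u, 0) = G (u, 0)"
  by (simp add: vavg_def)

lemma
  assumes "smooth_on (ball 0 r) G" "q \<in> ball 0 r"
  shows Du_vavg: "Du (vavg j G) q = vavg j (Du G) q"
    and Dv_vavg: "Dv (vavg j G) q = vavg (Suc j) (Dv G) q"
proof -
  have "Ck_on (Suc 0) (ball 0 r) G" using assms(1) unfolding smooth_on_def by blast
  from has_derivative_vavg[OF this assms(2), of j]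
  show "Du (vavg j G) q = vavg j (Du G) q" "Dv (vavg j G) q = vavg (Suc j) (Dv G) q"
    by (auto dest: has_derivative_Du has_derivative_Dv)
qed

lemma has_vector_derivative_shrink_snd:
  assumes "smooth_on (ball 0 r) X" "q \<in> ball 0 r" "0 \<le> t" "t \<le> 1"
  shows "((\<lambda>t. X (fst q, t * snd q)) has_vector_derivative snd q *\<^sub>R Dv X (fst q, t * snd q)) (at t)"
proof -
  have "((\<lambda>t::real. (fst q, t * snd q)) has_derivative (\<lambda>s. (0, s * snd q))) (at t)"
    by (auto intro!: derivative_eq_intros)
  from has_derivative_compose[OF this has_derivative_Du_Dv[OF smooth_on_imp_differentiable[OF assms(1) ball_shrink_snd[OF assms(2-4)]]]]
  show ?thesis by (simp add: has_vector_derivative_def)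
qed

text \<open>Hadamard's lemma: the remainder after the value on the axis is \<open>v\<close> times a smooth function.\<close>

lemma vavg_FTC:
  assumes X: "smooth_on (ball 0 r) X" and q: "q \<in> ball 0 r"
  shows "X q = X (fst q, 0) + snd q *\<^sub>R vavg 0 (Dv X) q"
proof -
  have "((\<lambda>t. snd q *\<^sub>R Dv X (fst q, t * snd q)) has_integral X (fst q, 1 * snd q) - X (fst q, 0 * snd q)) {0..1}"
    by (rule fundamental_theorem_of_calculus)
      (auto intro: has_vector_derivative_at_within has_vector_derivative_shrink_snd[OF X q])
  from integral_unique[OF this] show ?thesis
    by (simp add: vavg_def)
qed

text \<open>This is the integral over \<open>[0, 1]\<close> of the derivative of \<open>t X(u, t v)\<close>.  Together with
  \<open>Dv_vavg\<close> it says that \<open>X\<close> is the \<open>v\<close>-derivative of \<open>v\<close> times \<open>vavg 0 X\<close>.\<close>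

lemma vavg_by_parts:
  assumes X: "smooth_on (ball 0 r) X" and q: "q \<in> ball 0 r"
  shows "X q = vavg 0 X q + snd q *\<^sub>R vavg 1 (Dv X) q"
proof -
  have 1: "((\<lambda>t. t *\<^sub>R (snd q *\<^sub>R Dv X (fst q, t * snd q)) + 1 *\<^sub>R X (fst q, t * snd q))
      has_integral 1 *\<^sub>R X (fst q, 1 * snd q) - 0 *\<^sub>R X (fst q, 0 * snd q)) {0..1}"
    by (rule fundamental_theorem_of_calculus[OF _
          has_vector_derivative_at_within[OF has_vector_derivative_scaleR[OF DERIV_ident has_vector_derivative_shrink_snd[OF X q]]]])
      auto
  have "((\<lambda>t. snd q *\<^sub>R (t ^ 1 *\<^sub>R Dv X (fst q, t * snd q)) + t ^ 0 *\<^sub>R X (fst q, t * snd q))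
      has_integral snd q *\<^sub>R vavg 1 (Dv X) q + vavg 0 X q) {0..1}"
    unfolding vavg_def
    by (intro has_integral_add has_integral_cmul integrable_integral vavg_integrable[OF _ q]
        smooth_on_imp_continuous_on X smooth_on_Dv)
  then have "((\<lambda>t. t *\<^sub>R (snd q *\<^sub>R Dv X (fst q, t * snd q)) + 1 *\<^sub>R X (fst q, t * snd q))
      has_integral snd q *\<^sub>R vavg 1 (Dv X) q + vavg 0 X q) {0..1}"
    by (simp add: mult.commute)
  from has_integral_unique[OF 1 this] show ?thesis by simp
qed

text \<open>Expressing \<open>g\<^sub>u\<close> by Hadamard's lemma, and differentiating in \<open>u\<close> the expression of
  \<open>g\<close> by Hadamard's lemma, shows that \<open>(g\<^sub>u)\<^sub>v\<close> and \<open>(g\<^sub>v)\<^sub>u\<close> have the same integral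
  over every segment from the axis in the \<open>v\<close>-direction; so they are equal.\<close>

lemma Dv_Du_commute:
  assumes g: "smooth_on (ball 0 r) g" and q: "q \<in> ball 0 r"
  shows "Dv (Du g) q = Du (Dv g) q"
proof -
  define w where "w = (\<lambda>q. Dv (Du g) q - Du (Dv g) q)"
  note sm = smooth_on_Du smooth_on_Dv smooth_on_vavg g
  have sm_diff: "smooth_on (ball 0 r) (\<lambda>q. a q - b q)" if "smooth_on (ball 0 r) a" "smooth_on (ball 0 r) b"
    for a b :: "real \<times> real \<Rightarrow> 'a"
    using smooth_on_add[OF open_ball that(1) smooth_on_bounded_linear[OF bounded_linear_minus[OF bounded_linear_ident] open_ball that(2)]]
    by simp
  have w: "smooth_on (ball 0 r) w" unfolding w_def by (intro sm_diff sm)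
  \<comment> \<open>The integral of the difference of the two mixed derivatives along each segment vanishes.\<close>
  have zero: "snd p *\<^sub>R vavg 0 w p = 0" if p: "p \<in> ball 0 r" for p
  proof -
    have p0: "(fst p, 0::real) \<in> ball 0 r" using abs_fst_less[OF p] by (simp del: mem_ball)
    have 1: "Du g p = Du g (fst p, 0) + snd p *\<^sub>R vavg 0 (Dv (Du g)) p"
      by (rule vavg_FTC[OF _ p]) (intro sm)
    have d0: "((\<lambda>p. g (fst p, 0)) has_derivative (\<lambda>X. fst X *\<^sub>R Du g (fst p, 0))) (at p)"
    proof -
      have "((\<lambda>p::real\<times>real. (fst p, 0::real)) has_derivative (\<lambda>X. (fst X, 0))) (at p)"
        by (auto intro!: derivative_eq_intros)
      from has_derivative_compose[OF this has_derivative_Du_Dv[OF smooth_on_imp_differentiable[OF g p0]]]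
      show ?thesis by simp
    qed
    have dv: "vavg 0 (Dv g) differentiable (at p)"
      by (rule smooth_on_imp_differentiable[OF _ p]) (intro sm)
    have "Du g p = Du (\<lambda>p. g (fst p, 0) + snd p *\<^sub>R vavg 0 (Dv g) p) p"
      by (rule Du_cong[OF open_ball p vavg_FTC[OF g]])
    also have "\<dots> = Du g (fst p, 0) + snd p *\<^sub>R vavg 0 (Du (Dv g)) p"
      unfolding Du_add[OF differentiableI[OF d0] differentiableI[OF has_derivative_scaleR[OF
            has_derivative_Du_Dv[OF differentiable_snd] has_derivative_Du_Dv[OF dv]]]]
      by (simp add: has_derivative_Du[OF d0] Du_snd_scaleR[OF dv] Du_vavg[OF smooth_on_Dv[OF g] p])
    finally have "snd p *\<^sub>R (vavg 0 (Dv (Du g)) p - vavg 0 (Du (Dv g)) p) = 0"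
      using 1 by (simp add: scaleR_diff_right)
    moreover have "vavg 0 w p = vavg 0 (Dv (Du g)) p - vavg 0 (Du (Dv g)) p"
      unfolding vavg_def w_def scaleR_diff_right
      by (rule integral_diff; rule vavg_integrable[OF smooth_on_imp_continuous_on p]; intro sm)
    ultimately show ?thesis by simp
  qed
  have "0 = Dv (\<lambda>p. snd p *\<^sub>R vavg 0 w p) q"
    using Dv_cong[OF open_ball q zero] by simp
  also have "\<dots> = vavg 0 w q + snd q *\<^sub>R Dv (vavg 0 w) q"
    by (intro Dv_snd_scaleR smooth_on_imp_differentiable[OF _ q] smooth_on_vavg w)
  also have "\<dots> = w q"
    using vavg_by_parts[OF w q] Dv_vavg[OF w q, of 0] by simp
  finally show ?thesis by (simp add: w_def)
qed

text \<open>This replaces the definition by cases of \<open>quot_v\<close> by an expression that is visibly smooth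
  across the axis.\<close>

lemma quot_v_eq_vavg:
  assumes X: "smooth_on (ball 0 r) X" and zero: "\<And>u. \<bar>u\<bar> < r \<Longrightarrow> X (u, 0) = 0"
    and q: "q \<in> ball 0 r"
  shows "quot_v X q = vavg 0 (Dv X) q" and "X q = snd q *\<^sub>R vavg 0 (Dv X) q"
proof -
  show 1: "X q = snd q *\<^sub>R vavg 0 (Dv X) q"
    using vavg_FTC[OF X q] zero[OF abs_fst_less[OF q]] by simp
  show "quot_v X q = vavg 0 (Dv X) q"
  proof (cases "snd q = 0")
    case True
    then have "q = (fst q, 0)" by (simp add: prod_eq_iff)
    then show ?thesis using True vavg_axis by (metis quot_v_def)
  next
    case False
    then have "vavg 0 (Dv X) q = (1 / snd q) *\<^sub>R (snd q *\<^sub>R vavg 0 (Dv X) q)" by simp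
    then show ?thesis using False 1 by (simp add: quot_v_def)
  qed
qed

section \<open>Orthonormal frames\<close>

text \<open>The matrix with rows \<open>a, b, c\<close> has its transpose as right inverse, hence also as left inverse.\<close>

lemma orthonormal3_expand:
  fixes a b c x :: "real^3"
  assumes "a \<bullet> a = 1" "b \<bullet> b = 1" "c \<bullet> c = 1" "a \<bullet> b = 0" "a \<bullet> c = 0" "b \<bullet> c = 0"
  shows "x = (x \<bullet> a) *\<^sub>R a + (x \<bullet> b) *\<^sub>R b + (x \<bullet> c) *\<^sub>R c"
proof -
  define A :: "real^3^3" where "A = vector [a, b, c]"
  have "A ** transpose A = mat 1"
    using assms by (simp add: A_def vec_eq_iff matrix_matrix_mult_def transpose_def mat_def forall_3
      inner_vec_def sum_3 mult.commute)
  then have "transpose A ** A = mat 1" by (simp add: matrix_left_right_inverse)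
  then have "x = transpose A *v (A *v x)" by (simp add: matrix_vector_mul_assoc)
  also have "\<dots> = (x \<bullet> a) *\<^sub>R a + (x \<bullet> b) *\<^sub>R b + (x \<bullet> c) *\<^sub>R c"
    by (simp add: A_def vec_eq_iff matrix_vector_mult_def transpose_def forall_3
      inner_vec_def sum_3 mult.commute algebra_simps)
  finally show ?thesis .
qed

section \<open>Adapted frontals\<close>

lemmas smooth_intros = smooth_on_const smooth_on_inner smooth_on_scaleR smooth_on_mult smooth_on_add
  smooth_on_power smooth_on_snd smooth_on_Du smooth_on_Dv smooth_on_vavg open_ball

text \<open>The pointwise content of adapted coordinates on a fixed ball, in place of properties that hold
  eventually near the origin.  The axis is the singular set, also called the edge below.\<close>

locale adapted_frontal =
  fixes r :: real and g n :: "real \<times> real \<Rightarrow> real^3"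
  assumes smooth_g: "smooth_on (ball 0 r) g" and smooth_n: "smooth_on (ball 0 r) n"
    and n_n: "q \<in> ball 0 r \<Longrightarrow> n q \<bullet> n q = 1"
    and gu_n: "q \<in> ball 0 r \<Longrightarrow> Du g q \<bullet> n q = 0"
    and gv_n: "q \<in> ball 0 r \<Longrightarrow> Dv g q \<bullet> n q = 0"
    and gv_axis: "\<bar>u\<bar> < r \<Longrightarrow> Dv g (u, 0) = 0"
    and gu_gu_axis: "\<bar>u\<bar> < r \<Longrightarrow> Du g (u, 0) \<bullet> Du g (u, 0) = 1"
    and gvv_gvv_axis: "\<bar>u\<bar> < r \<Longrightarrow> Dv (Dv g) (u, 0) \<bullet> Dv (Dv g) (u, 0) = 1"
    and gu_gvv_axis: "\<bar>u\<bar> < r \<Longrightarrow> Du g (u, 0) \<bullet> Dv (Dv g) (u, 0) = 0"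
begin

abbreviation "h \<equiv> h_of g"

lemma smooth_h: "smooth_on (ball 0 r) h"
  unfolding h_of_def
  by (rule smooth_on_cong[OF open_ball quot_v_eq_vavg(1)[symmetric]])
    (auto intro!: smooth_intros smooth_g gv_axis simp del: mem_ball)

lemma gv_eq: "q \<in> ball 0 r \<Longrightarrow> Dv g q = snd q *\<^sub>R h q"
  unfolding h_of_def using quot_v_eq_vavg[OF smooth_on_Dv[OF smooth_g] gv_axis, of q]
  by simp

lemmas sm = smooth_intros smooth_g smooth_n smooth_h
lemmas diff = smooth_on_imp_differentiable[where U = "ball 0 r"]

lemma h_axis: "h (u, 0) = Dv (Dv g) (u, 0)"
  by (simp add: h_of_def quot_v_def)

lemma hh_axis: "\<bar>u\<bar> < r \<Longrightarrow> h (u, 0) \<bullet> h (u, 0) = 1"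
  and gu_h_axis: "\<bar>u\<bar> < r \<Longrightarrow> Du g (u, 0) \<bullet> h (u, 0) = 0"
  by (simp_all add: h_axis gvv_gvv_axis gu_gvv_axis)

lemma h_n: "q \<in> ball 0 r \<Longrightarrow> h q \<bullet> n q = 0"
proof (rule axis_cancel[where r = r and b = "\<lambda>_. 0"])
  show "snd p *\<^sub>R (h p \<bullet> n p) = snd p *\<^sub>R 0" if "p \<in> ball 0 r" for p
    using gv_n[OF that] gv_eq[OF that] by simp
qed (intro sm | assumption)+

lemma guv_eq:
  assumes q: "q \<in> ball 0 r"
  shows "Dv (Du g) q = snd q *\<^sub>R Du h q"
proof -
  have "Dv (Du g) q = Du (\<lambda>q. snd q *\<^sub>R h q) q"
    using Dv_Du_commute[OF smooth_g q] Du_cong[OF open_ball q gv_eq] by simp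
  then show ?thesis by (simp add: Du_snd_scaleR[OF diff[OF smooth_h q]])
qed

lemma frame_expand:
  assumes "\<bar>u\<bar> < r"
  shows "x = (x \<bullet> Du g (u, 0)) *\<^sub>R Du g (u, 0) + (x \<bullet> h (u, 0)) *\<^sub>R h (u, 0)
    + (x \<bullet> n (u, 0)) *\<^sub>R n (u, 0)"
  using assms by (intro orthonormal3_expand)
    (simp_all add: gu_gu_axis hh_axis n_n gu_h_axis gu_n h_n del: mem_ball)

lemma
  assumes q: "q \<in> ball 0 r"
  shows nu_n: "Du n q \<bullet> n q = 0" and nv_n: "Dv n q \<bullet> n q = 0"
  using Du_cong[OF open_ball q n_n] Dv_cong[OF open_ball q n_n]
    Du_inner[OF diff[OF smooth_n q] diff[OF smooth_n q]]
    Dv_inner[OF diff[OF smooth_n q] diff[OF smooth_n q]]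
  by (simp_all add: inner_commute)

lemma
  assumes q: "q \<in> ball 0 r"
  shows hu_n: "Du h q \<bullet> n q = - (h q \<bullet> Du n q)" and hv_n: "Dv h q \<bullet> n q = - (h q \<bullet> Dv n q)"
  using Du_cong[OF open_ball q h_n] Dv_cong[OF open_ball q h_n]
    Du_inner[OF diff[OF smooth_h q] diff[OF smooth_n q]]
    Dv_inner[OF diff[OF smooth_h q] diff[OF smooth_n q]]
  by simp_all

text \<open>\<open>\<langle>g\<^sub>u, n\<rangle> = 0\<close> is differentiated in \<open>v\<close>, and \<open>g\<^sub>u\<^sub>v = v h\<^sub>u\<close>.\<close>

lemma gu_nv:
  assumes q: "q \<in> ball 0 r"
  shows "Du g q \<bullet> Dv n q = - (snd q * (Du h q \<bullet> n q))"
  using Dv_cong[OF open_ball q gu_n] guv_eq[OF q]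
    Dv_inner[OF diff[OF smooth_on_Du[OF smooth_g] q] diff[OF smooth_n q]]
  by simp

text \<open>On the edge \<open>n\<^sub>v\<close> is orthogonal to \<open>n\<close> and to \<open>g\<^sub>u\<close>, so its only component is the one
  along \<open>h\<close>, which is minus \<open>\<langle>h\<^sub>v, n\<rangle>\<close>.\<close>

lemma nv_axis_iff:
  assumes "\<bar>u\<bar> < r"
  shows "Dv n (u, 0) = 0 \<longleftrightarrow> Dv h (u, 0) \<bullet> n (u, 0) = 0"
proof -
  have q: "(u, 0::real) \<in> ball 0 r" using assms by (simp del: mem_ball)
  have "Dv n (u, 0) = (Dv n (u, 0) \<bullet> h (u, 0)) *\<^sub>R h (u, 0)"
    by (subst frame_expand[OF assms, of "Dv n (u, 0)"])
      (use gu_nv[OF q] nv_n[OF q] in \<open>simp add: inner_commute\<close>)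
  then show ?thesis using hv_n[OF q] by (metis inner_commute inner_zero_left neg_equal_0_iff_equal scale_zero_left)
qed

end

text \<open>The condition of a pure-frontal singular point, required along the whole edge: it is what
  makes \<open>\<nu>\<^sub>1\<close> smooth and the curvatures extend smoothly.\<close>

locale pure_frontal = adapted_frontal +
  assumes nv_axis: "\<bar>u\<bar> < r \<Longrightarrow> Dv n (u, 0) = 0"
begin

abbreviation "m \<equiv> nu1_of n"

lemma smooth_m: "smooth_on (ball 0 r) m"
  unfolding nu1_of_def
  by (rule smooth_on_cong[OF open_ball quot_v_eq_vavg(1)[symmetric]])
    (auto intro!: smooth_intros smooth_n nv_axis simp del: mem_ball)

lemma nv_eq: "q \<in> ball 0 r \<Longrightarrow> Dv n q = snd q *\<^sub>R m q"
  unfolding nu1_of_def using quot_v_eq_vavg[OF smooth_on_Dv[OF smooth_n] nv_axis, of q]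
  by simp

lemma hv_n_eq: "q \<in> ball 0 r \<Longrightarrow> Dv h q \<bullet> n q = snd q * tN1 g n q"
  by (simp add: hv_n nv_eq tN1_def)

lemma hu_n_eq: "q \<in> ball 0 r \<Longrightarrow> Du h q \<bullet> n q = tM g n q"
  by (simp add: hu_n tM_def)

text \<open>The mixed coefficient of the second fundamental form can be computed with the roles of the two
  parameters exchanged; both versions agree after multiplication by \<open>v\<close>.\<close>

lemma gu_m: "q \<in> ball 0 r \<Longrightarrow> Du g q \<bullet> m q = - tM g n q"
  unfolding eq_neg_iff_add_eq_0
proof (rule axis_cancel[where r = r and b = "\<lambda>_. 0"])
  show "smooth_on (ball 0 r) (\<lambda>q. Du g q \<bullet> m q + tM g n q)"
    by (rule smooth_on_cong[where f = "\<lambda>q. Du g q \<bullet> m q + Du h q \<bullet> n q"])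
      (auto intro!: sm smooth_m simp: hu_n_eq simp del: mem_ball)
  show "snd p *\<^sub>R (Du g p \<bullet> m p + tM g n p) = snd p *\<^sub>R 0" if "p \<in> ball 0 r" for p
    using gu_nv[OF that] nv_eq[OF that] hu_n_eq[OF that] by (simp add: algebra_simps)
qed (intro sm | assumption)+

lemma smooth_forms:
  "smooth_on (ball 0 r) (tE g)" "smooth_on (ball 0 r) (tF g)" "smooth_on (ball 0 r) (tG g)"
  "smooth_on (ball 0 r) (tL g n)" "smooth_on (ball 0 r) (tM g n)" "smooth_on (ball 0 r) (tN1 g n)"
  unfolding tE_def[abs_def] tF_def[abs_def] tG_def[abs_def] tL_def[abs_def] tM_def[abs_def] tN1_def[abs_def]
  by (intro sm smooth_m smooth_on_bounded_linear[OF bounded_linear_minus[OF bounded_linear_ident]])+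

text \<open>The normal component is absent because of \<open>\<langle>h\<^sub>v, n\<rangle> = v N\<close>; the two tangential ones are
  read off from the derivatives of \<open>F\<close> and \<open>G\<close>.\<close>

lemma hv_axis:
  assumes u: "\<bar>u\<bar> < r"
  shows "Dv h (u, 0) = Dv (tF g) (u, 0) *\<^sub>R Du g (u, 0) + (Dv (tG g) (u, 0) / 2) *\<^sub>R h (u, 0)"
proof -
  let ?q = "(u, 0::real)"
  have q: "?q \<in> ball 0 r" using u by (simp del: mem_ball)
  have "Dv (tF g) ?q = Du g ?q \<bullet> Dv h ?q"
    unfolding tF_def[abs_def] Dv_inner[OF diff[OF smooth_on_Du[OF smooth_g] q] diff[OF smooth_h q]] guv_eq[OF q]
    by simp
  moreover have "Dv (tG g) ?q = 2 * (h ?q \<bullet> Dv h ?q)"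
    unfolding tG_def[abs_def] Dv_inner[OF diff[OF smooth_h q] diff[OF smooth_h q]]
    by (simp add: inner_commute)
  moreover have "Dv h ?q \<bullet> n ?q = 0" by (simp add: hv_n_eq[OF q])
  ultimately show ?thesis
    by (subst frame_expand[OF u, of "Dv h ?q"]) (simp add: inner_commute)
qed

text \<open>Both follow by differentiating \<open>\<langle>n, h\<^sub>v\<rangle> = v N\<close> in \<open>v\<close>, once and twice.\<close>

lemma
  assumes u: "\<bar>u\<bar> < r"
  shows hvv_n_axis: "n (u, 0) \<bullet> Dv (Dv h) (u, 0) = tN1 g n (u, 0)"
    and hvvv_n_axis: "n (u, 0) \<bullet> Dv (Dv (Dv h)) (u, 0) = 2 * Dv (tN1 g n) (u, 0)
      + Dv (tF g) (u, 0) * tM g n (u, 0) + Dv (tG g) (u, 0) / 2 * tN1 g n (u, 0)"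
proof -
  let ?q = "(u, 0::real)"
  have q0: "?q \<in> ball 0 r" using u by (simp del: mem_ball)
  note sN = smooth_forms(6)
  have 1: "n q \<bullet> Dv (Dv h) q + snd q * (m q \<bullet> Dv h q) = tN1 g n q + snd q * Dv (tN1 g n) q"
    if q: "q \<in> ball 0 r" for q
  proof -
    have "Dv (\<lambda>q. n q \<bullet> Dv h q) q = Dv (\<lambda>q. snd q *\<^sub>R tN1 g n q) q"
      by (rule Dv_cong[OF open_ball q]) (use hv_n_eq in \<open>simp add: inner_commute\<close>)
    then show ?thesis
      unfolding Dv_snd_scaleR[OF diff[OF sN q]]
        Dv_inner[OF diff[OF smooth_n q] diff[OF smooth_on_Dv[OF smooth_h] q]] nv_eq[OF q]
      by simp
  qed
  from 1[OF q0] show "n ?q \<bullet> Dv (Dv h) ?q = tN1 g n ?q" by simp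
  have s1: "smooth_on (ball 0 r) (\<lambda>q. m q \<bullet> Dv h q)"
    and s2: "smooth_on (ball 0 r) (\<lambda>q. n q \<bullet> Dv (Dv h) q)"
    and s3: "smooth_on (ball 0 r) (\<lambda>q. snd q *\<^sub>R (m q \<bullet> Dv h q))"
    and s4: "smooth_on (ball 0 r) (\<lambda>q. snd q *\<^sub>R Dv (tN1 g n) q)"
    by (intro sm smooth_m sN)+
  have "Dv (\<lambda>q. n q \<bullet> Dv (Dv h) q + snd q *\<^sub>R (m q \<bullet> Dv h q)) ?q
      = Dv (\<lambda>q. tN1 g n q + snd q *\<^sub>R Dv (tN1 g n) q) ?q"
    by (rule Dv_cong[OF open_ball q0]) (use 1 in simp)
  then have "n ?q \<bullet> Dv (Dv (Dv h)) ?q + m ?q \<bullet> Dv h ?q = 2 * Dv (tN1 g n) ?q"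
    unfolding Dv_add[OF diff[OF s2 q0] diff[OF s3 q0]] Dv_add[OF diff[OF sN q0] diff[OF s4 q0]]
      Dv_snd_scaleR[OF diff[OF s1 q0]] Dv_snd_scaleR[OF diff[OF smooth_on_Dv[OF sN] q0]]
      Dv_inner[OF diff[OF smooth_n q0] diff[OF smooth_on_Dv[OF smooth_on_Dv[OF smooth_h]] q0]] nv_eq[OF q0]
    by simp
  moreover have "m ?q \<bullet> Dv h ?q = - (Dv (tF g) ?q * tM g n ?q) - Dv (tG g) ?q / 2 * tN1 g n ?q"
    using gu_m[OF q0] unfolding hv_axis[OF u] by (simp add: inner_add_right inner_commute tN1_def)
  ultimately show "n ?q \<bullet> Dv (Dv (Dv h)) ?q = 2 * Dv (tN1 g n) ?q
      + Dv (tF g) ?q * tM g n ?q + Dv (tG g) ?q / 2 * tN1 g n ?q"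
    by simp
qed

end

section \<open>What the 5/2-cuspidal edge contributes\<close>

lemma has_derivative_snd_power:
  "((\<lambda>q::real \<times> real. snd q ^ Suc j) has_derivative (\<lambda>X. real (Suc j) * snd q ^ j * snd X)) (at q)"
  using has_derivative_power[OF bounded_linear_imp_has_derivative[OF bounded_linear_snd], of "Suc j" q UNIV]
  by (simp add: mult_ac)

lemma
  fixes c :: "real \<times> real \<Rightarrow> real"
  assumes "c differentiable (at q)"
  shows Du_snd_power_mult: "Du (\<lambda>q. snd q ^ Suc j * c q) q = snd q ^ Suc j * Du c q"
    and Dv_snd_power_mult: "Dv (\<lambda>q. snd q ^ Suc j * c q) q =
      real (Suc j) * snd q ^ j * c q + snd q ^ Suc j * Dv c q"
  using Du_mult[OF differentiableI[OF has_derivative_snd_power] assms, of j]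
    Dv_mult[OF differentiableI[OF has_derivative_snd_power] assms, of j]
    has_derivative_Du[OF has_derivative_snd_power, of j q]
    has_derivative_Dv[OF has_derivative_snd_power, of j q]
  by simp_all

lemma
  assumes F: "smooth_on V F" and q: "g q \<in> V" and g: "g differentiable (at q)"
  shows Du_compose: "Du (\<lambda>q. F (g q)) q = frechet_derivative F (at (g q)) (Du g q)"
    and Dv_compose: "Dv (\<lambda>q. F (g q)) q = frechet_derivative F (at (g q)) (Dv g q)"
proof -
  have "(F has_derivative frechet_derivative F (at (g q))) (at (g q))"
    using smooth_on_imp_differentiable[OF F q] by (simp add: frechet_derivative_works)
  from has_derivative_compose[OF has_derivative_Du_Dv[OF g] this]
  show "Du (\<lambda>q. F (g q)) q = frechet_derivative F (at (g q)) (Du g q)"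
    "Dv (\<lambda>q. F (g q)) q = frechet_derivative F (at (g q)) (Dv g q)"
    by (simp_all add: has_derivative_Du has_derivative_Dv)
qed

text \<open>The part of the normal form \<open>(u, v\<^sup>2, v\<^sup>5)\<close> that matters: \<open>\<psi>\<close> is the third target
  coordinate and \<open>y\<close> the second source coordinate in which \<open>g\<close> has that form.\<close>

locale quintic_contact = adapted_frontal +
  fixes V and \<psi> :: "real^3 \<Rightarrow> real" and y :: "real \<times> real \<Rightarrow> real"
  assumes open_V: "open V" and smooth_\<psi>: "smooth_on V \<psi>" and g_V: "g ` ball 0 r \<subseteq> V"
    and smooth_y: "smooth_on (ball 0 r) y"
    and \<psi>_g: "q \<in> ball 0 r \<Longrightarrow> \<psi> (g q) = y q ^ 5"
    and y_axis: "\<bar>u\<bar> < r \<Longrightarrow> y (u, 0) = 0"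
    and yv_axis: "\<bar>u\<bar> < r \<Longrightarrow> Dv y (u, 0) \<noteq> 0"
    and d\<psi>_nonzero: "\<bar>u\<bar> < r \<Longrightarrow> frechet_derivative \<psi> (at (g (u, 0))) \<noteq> (\<lambda>_. 0)"
begin

definition grad :: "real^3 \<Rightarrow> real^3" where
  "grad p = (\<Sum>c\<in>Basis. frechet_derivative \<psi> (at p) c *\<^sub>R c)"

text \<open>\<open>P\<close> is the gradient of \<open>\<psi>\<close> along \<open>g\<close>, and \<open>R\<close> its Hessian there applied to \<open>h\<close>.
  Since \<open>g\<^sub>v = v h\<close>, the chain rule gives \<open>P\<^sub>v = v R\<close>.\<close>

definition P :: "real \<times> real \<Rightarrow> real^3" where "P q = grad (g q)"

definition R :: "real \<times> real \<Rightarrow> real^3" where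
  "R q = (\<Sum>c\<in>Basis. (h q \<bullet> c) *\<^sub>R frechet_derivative grad (at (g q)) c)"

lemma linear_frechet: "smooth_on V F \<Longrightarrow> p \<in> V \<Longrightarrow> linear (frechet_derivative F (at p))"
  by (metis smooth_on_imp_differentiable frechet_derivative_works has_derivative_linear)

lemma g_in_V: "q \<in> ball 0 r \<Longrightarrow> g q \<in> V"
  using g_V by blast

lemma grad_inner:
  assumes "p \<in> V"
  shows "grad p \<bullet> X = frechet_derivative \<psi> (at p) X"
  unfolding linear_euclidean_expansion[OF linear_frechet[OF smooth_\<psi> assms], of X]
  by (simp add: grad_def inner_sum_left inner_commute[of X] mult.commute)

lemma smooth_grad: "smooth_on V grad"
  unfolding grad_def
  by (intro smooth_on_sum smooth_on_scaleR smooth_on_const smooth_on_frechet_derivative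
      smooth_\<psi> open_V finite_Basis)

lemma smooth_compose_g: "smooth_on V F \<Longrightarrow> smooth_on (ball 0 r) (\<lambda>q. F (g q))"
  by (rule smooth_on_compose[OF open_ball open_V g_V _ smooth_g])

lemma smooth_P: "smooth_on (ball 0 r) P"
  unfolding P_def by (rule smooth_compose_g[OF smooth_grad])

lemma smooth_R: "smooth_on (ball 0 r) R"
  unfolding R_def
  by (intro smooth_on_sum smooth_on_scaleR smooth_on_inner smooth_on_const open_ball finite_Basis smooth_h
      smooth_compose_g smooth_on_frechet_derivative smooth_grad)

lemmas smP = sm smooth_P smooth_R smooth_y

lemma R_eq:
  assumes q: "q \<in> ball 0 r"
  shows "R q = frechet_derivative grad (at (g q)) (h q)"
  using linear_euclidean_expansion[OF linear_frechet[OF smooth_grad g_in_V[OF q]], of "h q"]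
  by (simp add: R_def)

lemma
  assumes q: "q \<in> ball 0 r"
  shows Pv: "Dv P q = snd q *\<^sub>R R q" and Pu: "Du P q = frechet_derivative grad (at (g q)) (Du g q)"
proof -
  have gq: "g q \<in> V" using q g_V by auto
  note c = Du_compose[OF smooth_grad gq diff[OF smooth_g q]] Dv_compose[OF smooth_grad gq diff[OF smooth_g q]]
  show "Dv P q = snd q *\<^sub>R R q" "Du P q = frechet_derivative grad (at (g q)) (Du g q)"
    unfolding P_def using c linear_scale[OF linear_frechet[OF smooth_grad gq]]
    by (simp_all add: R_eq[OF q] gv_eq[OF q])
qed

text \<open>Only \<open>h\<close> contributes: the Hessian along \<open>g\<close> has zero \<open>v\<close>-derivative on the edge because
  \<open>g\<^sub>v\<close> vanishes there.\<close>

lemma Rv_axis: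
  assumes u: "\<bar>u\<bar> < r"
  shows "Dv R (u, 0) = frechet_derivative grad (at (g (u, 0))) (Dv h (u, 0))"
proof -
  let ?q = "(u, 0::real)"
  have q: "?q \<in> ball 0 r" using u by (simp del: mem_ball)
  then have gq: "g ?q \<in> V" using g_V by auto
  have dh: "((\<lambda>q. h q \<bullet> c) has_derivative (\<lambda>X. (fst X *\<^sub>R Du h ?q + snd X *\<^sub>R Dv h ?q) \<bullet> c)) (at ?q)" for c
    by (rule bounded_linear.has_derivative[OF bounded_linear_inner_left has_derivative_Du_Dv[OF diff[OF smooth_h q]]])
  define Q where "Q c = (\<lambda>q. frechet_derivative grad (at (g q)) c)" for c
  have sQ: "smooth_on (ball 0 r) (Q c)" for c
    unfolding Q_def by (intro smooth_compose_g smooth_on_frechet_derivative smooth_grad)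
  have Qv: "Dv (Q c) ?q = 0" for c
    using Dv_compose[OF smooth_on_frechet_derivative[OF smooth_grad] gq diff[OF smooth_g q]] gv_axis[OF u]
      linear_0[OF linear_frechet[OF smooth_on_frechet_derivative[OF smooth_grad] gq]]
    unfolding Q_def by simp
  have "(R has_derivative (\<lambda>X. \<Sum>c\<in>Basis. (h ?q \<bullet> c) *\<^sub>R (fst X *\<^sub>R Du (Q c) ?q + snd X *\<^sub>R Dv (Q c) ?q)
      + ((fst X *\<^sub>R Du h ?q + snd X *\<^sub>R Dv h ?q) \<bullet> c) *\<^sub>R Q c ?q)) (at ?q)"
    unfolding R_def Q_def[symmetric, THEN fun_cong]
    by (intro has_derivative_sum has_derivative_scaleR dh has_derivative_Du_Dv diff[OF sQ q])
  then have "Dv R ?q = (\<Sum>c\<in>Basis. (Dv h ?q \<bullet> c) *\<^sub>R Q c ?q)"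
    by (simp add: has_derivative_Dv Qv)
  also have "\<dots> = frechet_derivative grad (at (g ?q)) (Dv h ?q)"
    by (simp add: Q_def linear_euclidean_expansion[OF linear_frechet[OF smooth_grad gq], of "Dv h ?q"])
  finally show ?thesis .
qed

text \<open>By Hadamard's lemma \<open>y = v b\<close>, hence \<open>\<psi> \<circ> g = v\<^sup>5 b\<^sup>5\<close>; the function \<open>\<beta>\<close> is chosen
  so that the \<open>v\<close>-derivative of the right-hand side is \<open>v\<^sup>4 \<beta>\<close>.\<close>

definition b :: "real \<times> real \<Rightarrow> real" where "b = vavg 0 (Dv y)"
definition \<beta> :: "real \<times> real \<Rightarrow> real" where "\<beta> q = 5 * b q ^ 5 + snd q * Dv (\<lambda>q. b q ^ 5) q"

lemma smooth_b5: "smooth_on (ball 0 r) (\<lambda>q. b q ^ 5)"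
  unfolding b_def by (intro smP)

lemma smooth_\<beta>: "smooth_on (ball 0 r) \<beta>"
  unfolding \<beta>_def[abs_def] by (intro smP smooth_b5)

lemma \<beta>_axis: "\<bar>u\<bar> < r \<Longrightarrow> \<beta> (u, 0) \<noteq> 0"
  by (simp add: \<beta>_def b_def vavg_axis yv_axis)

lemma \<psi>_g_eq: "q \<in> ball 0 r \<Longrightarrow> \<psi> (g q) = snd q ^ 5 * b q ^ 5"
  using vavg_FTC[OF smooth_y, of q] y_axis[OF abs_fst_less, of q] \<psi>_g[of q]
  by (simp add: b_def power_mult_distrib)

lemma P_Du_g:
  assumes q: "q \<in> ball 0 r"
  shows "P q \<bullet> Du g q = snd q ^ 5 * Du (\<lambda>q. b q ^ 5) q"
proof -
  have gq: "g q \<in> V" using q g_V by auto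
  have "P q \<bullet> Du g q = Du (\<lambda>q. \<psi> (g q)) q"
    using Du_compose[OF smooth_\<psi> gq diff[OF smooth_g q]] by (simp add: P_def grad_inner[OF gq])
  also have "\<dots> = Du (\<lambda>q. snd q ^ Suc 4 * b q ^ 5) q"
    by (rule Du_cong[OF open_ball q]) (use \<psi>_g_eq in simp)
  finally show ?thesis using Du_snd_power_mult[OF diff[OF smooth_b5 q], of 4] by simp
qed

text \<open>The \<open>v\<close>-derivative of \<open>\<psi> \<circ> g\<close> is \<open>v\<close> times the left-hand side, so one factor \<open>v\<close> of
  \<open>v\<^sup>4 \<beta>\<close> cancels.\<close>

lemma P_h:
  assumes "q \<in> ball 0 r"
  shows "P q \<bullet> h q = snd q ^ 3 * \<beta> q"
proof -
  have "snd q *\<^sub>R (P q \<bullet> h q) = snd q *\<^sub>R (snd q ^ 3 * \<beta> q)" if q: "q \<in> ball 0 r" for q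
  proof -
    have gq: "g q \<in> V" using q g_V by auto
    have "snd q *\<^sub>R (P q \<bullet> h q) = P q \<bullet> Dv g q" by (simp add: gv_eq[OF q])
    also have "\<dots> = Dv (\<lambda>q. \<psi> (g q)) q"
      using Dv_compose[OF smooth_\<psi> gq diff[OF smooth_g q]] by (simp add: P_def grad_inner[OF gq])
    also have "\<dots> = Dv (\<lambda>q. snd q ^ Suc 4 * b q ^ 5) q"
      by (rule Dv_cong[OF open_ball q]) (use \<psi>_g_eq in simp)
    also have "\<dots> = snd q *\<^sub>R (snd q ^ 3 * \<beta> q)"
      unfolding Dv_snd_power_mult[OF diff[OF smooth_b5 q]] by (simp add: \<beta>_def algebra_simps eval_nat_numeral)
    finally show ?thesis .
  qed
  from axis_cancel[OF _ _ assms this] show ?thesis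
    using smooth_on_inner[OF open_ball smooth_P smooth_h]
      smooth_on_mult[OF open_ball smooth_on_power[OF open_ball smooth_on_snd[OF open_ball]] smooth_\<beta>]
    by blast
qed

text \<open>The \<open>v\<close>-derivatives of \<open>P_h\<close> and \<open>P_Du_g\<close>.\<close>

lemma
  assumes q: "q \<in> ball 0 r"
  shows R_h: "snd q * (R q \<bullet> h q) + P q \<bullet> Dv h q = snd q ^ 2 * (3 * \<beta> q + snd q * Dv \<beta> q)"
    and R_Du_g: "snd q * (R q \<bullet> Du g q) + snd q * (P q \<bullet> Du h q)
      = snd q ^ 4 * (5 * Du (\<lambda>q. b q ^ 5) q + snd q * Dv (Du (\<lambda>q. b q ^ 5)) q)"
proof -
  have "Dv (\<lambda>q. P q \<bullet> h q) q = Dv (\<lambda>q. snd q ^ Suc 2 * \<beta> q) q"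
    by (rule Dv_cong[OF open_ball q]) (use P_h in simp)
  then show "snd q * (R q \<bullet> h q) + P q \<bullet> Dv h q = snd q ^ 2 * (3 * \<beta> q + snd q * Dv \<beta> q)"
    unfolding Dv_snd_power_mult[OF diff[OF smooth_\<beta> q]]
      Dv_inner[OF diff[OF smooth_P q] diff[OF smooth_h q]] Pv[OF q]
    by (simp add: algebra_simps eval_nat_numeral)
  have "Dv (\<lambda>q. P q \<bullet> Du g q) q = Dv (\<lambda>q. snd q ^ Suc 4 * Du (\<lambda>q. b q ^ 5) q) q"
    by (rule Dv_cong[OF open_ball q]) (use P_Du_g in simp)
  then show "snd q * (R q \<bullet> Du g q) + snd q * (P q \<bullet> Du h q)
      = snd q ^ 4 * (5 * Du (\<lambda>q. b q ^ 5) q + snd q * Dv (Du (\<lambda>q. b q ^ 5)) q)"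
    unfolding Dv_snd_power_mult[OF diff[OF smooth_on_Du[OF smooth_b5] q]]
      Dv_inner[OF diff[OF smooth_P q] diff[OF smooth_on_Du[OF smooth_g] q]] Pv[OF q] guv_eq[OF q]
    by (simp add: algebra_simps eval_nat_numeral)
qed

text \<open>On the edge \<open>P\<close> is orthogonal to \<open>g\<^sub>u\<close> and \<open>h\<close>, and the differential of \<open>\<psi>\<close> does not
  vanish.\<close>

lemma P_axis:
  assumes u: "\<bar>u\<bar> < r"
  shows "P (u, 0) = (P (u, 0) \<bullet> n (u, 0)) *\<^sub>R n (u, 0)" and "P (u, 0) \<bullet> n (u, 0) \<noteq> 0"
proof -
  let ?q = "(u, 0::real)"
  have q: "?q \<in> ball 0 r" using u by (simp del: mem_ball)
  show 1: "P ?q = (P ?q \<bullet> n ?q) *\<^sub>R n ?q"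
    by (subst frame_expand[OF u, of "P ?q"]) (simp add: P_h[OF q] P_Du_g[OF q])
  have "P ?q \<noteq> 0"
  proof
    assume "P ?q = 0"
    then have "frechet_derivative \<psi> (at (g ?q)) X = 0" for X
      using grad_inner[OF g_in_V[OF q], of X] by (simp add: P_def)
    then show False using d\<psi>_nonzero[OF u] by auto
  qed
  then show "P ?q \<bullet> n ?q \<noteq> 0" using 1 by force
qed

text \<open>On the edge the first derivative of \<open>\<langle>P, h\<rangle> = v\<^sup>3 \<beta>\<close> says that \<open>P\<close>, hence also
  \<open>n\<close>, is orthogonal to \<open>h\<^sub>v\<close>.\<close>

lemma is_pure: "pure_frontal r g n"
proof
  fix u :: real assume u: "\<bar>u\<bar> < r"
  let ?q = "(u, 0::real)"
  have q: "?q \<in> ball 0 r" using u by (simp del: mem_ball)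
  have "(P ?q \<bullet> n ?q) * (n ?q \<bullet> Dv h ?q) = P ?q \<bullet> Dv h ?q"
    by (subst (2) P_axis(1)[OF u]) simp
  also have "\<dots> = 0" using R_h[OF q] by simp
  finally show "Dv n ?q = 0"
    using P_axis(2)[OF u] nv_axis_iff[OF u] by (simp add: inner_commute)
qed

sublocale pure_frontal r g n by (rule is_pure)

text \<open>The second and third \<open>v\<close>-derivatives of \<open>\<langle>P, h\<rangle> = v\<^sup>3 \<beta>\<close> on the edge, with
  \<open>P\<^sub>v = v R\<close> inserted.\<close>

lemma P_h_higher_derivatives_axis:
  assumes u: "\<bar>u\<bar> < r"
  shows "R (u, 0) \<bullet> h (u, 0) + P (u, 0) \<bullet> Dv (Dv h) (u, 0) = 0"
    and "2 * (Dv R (u, 0) \<bullet> h (u, 0)) + 3 * (R (u, 0) \<bullet> Dv h (u, 0))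
      + P (u, 0) \<bullet> Dv (Dv (Dv h)) (u, 0) = 6 * \<beta> (u, 0)"
proof -
  let ?q = "(u, 0::real)"
  have q0: "?q \<in> ball 0 r" using u by (simp del: mem_ball)
  define S where "S = (\<lambda>q. R q \<bullet> h q)"
  define \<gamma> where "\<gamma> = (\<lambda>q. 3 * \<beta> q + snd q * Dv \<beta> q)"
  have sS: "smooth_on (ball 0 r) S" unfolding S_def by (intro smP)
  have s\<gamma>: "smooth_on (ball 0 r) \<gamma>" unfolding \<gamma>_def by (intro smP smooth_\<beta>)
  \<comment> \<open>The second derivative is needed on the whole ball, because it is differentiated once more.\<close>
  have 2: "S q + snd q * Dv S q + snd q * (R q \<bullet> Dv h q) + P q \<bullet> Dv (Dv h) q
      = snd q ^ Suc 0 * (2 * \<gamma> q + snd q * Dv \<gamma> q)" if q: "q \<in> ball 0 r" for q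
  proof -
    note d = diff[OF sS q] diff[OF smooth_P q] diff[OF smooth_on_Dv[OF smooth_h] q]
      diff[OF s\<gamma> q]
    have "Dv (\<lambda>q. snd q *\<^sub>R S q + P q \<bullet> Dv h q) q = Dv (\<lambda>q. snd q ^ Suc 1 * \<gamma> q) q"
      by (rule Dv_cong[OF open_ball q]) (use R_h in \<open>simp add: S_def \<gamma>_def eval_nat_numeral\<close>)
    moreover have "Dv (\<lambda>q. snd q *\<^sub>R S q + P q \<bullet> Dv h q) q
        = Dv (\<lambda>q. snd q *\<^sub>R S q) q + Dv (\<lambda>q. P q \<bullet> Dv h q) q"
      by (rule Dv_add; rule diff[OF _ q]; intro smP sS)
    ultimately show ?thesis
      unfolding Dv_snd_power_mult[OF d(4)] Dv_snd_scaleR[OF d(1)] Dv_inner[OF d(2,3)] Pv[OF q]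
      by (simp add: algebra_simps)
  qed
  from 2[OF q0] show "R ?q \<bullet> h ?q + P ?q \<bullet> Dv (Dv h) ?q = 0" by (simp add: S_def)
  have s1: "smooth_on (ball 0 r) (\<lambda>q. R q \<bullet> Dv h q)"
    and s3: "smooth_on (ball 0 r) (\<lambda>q. 2 * \<gamma> q + snd q * Dv \<gamma> q)"
    by (intro smP s\<gamma> sS)+
  have "Dv (\<lambda>q. S q + snd q *\<^sub>R Dv S q + snd q *\<^sub>R (R q \<bullet> Dv h q) + P q \<bullet> Dv (Dv h) q) ?q
      = Dv (\<lambda>q. snd q ^ Suc 0 * (2 * \<gamma> q + snd q * Dv \<gamma> q)) ?q"
    by (rule Dv_cong[OF open_ball q0]) (use 2 in simp)
  also have "\<dots> = 2 * \<gamma> ?q"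
    unfolding Dv_snd_power_mult[OF diff[OF s3 q0]] by simp
  also have "Dv (\<lambda>q. S q + snd q *\<^sub>R Dv S q + snd q *\<^sub>R (R q \<bullet> Dv h q) + P q \<bullet> Dv (Dv h) q) ?q
      = Dv S ?q + Dv (\<lambda>q. snd q *\<^sub>R Dv S q) ?q + Dv (\<lambda>q. snd q *\<^sub>R (R q \<bullet> Dv h q)) ?q
        + Dv (\<lambda>q. P q \<bullet> Dv (Dv h) q) ?q"
    by (subst Dv_add Dv_add, (rule diff[OF _ q0], intro smP sS)+)+ simp
  also have "\<dots> = Dv S ?q + Dv S ?q + R ?q \<bullet> Dv h ?q + P ?q \<bullet> Dv (Dv (Dv h)) ?q"
    unfolding Dv_snd_scaleR[OF diff[OF smooth_on_Dv[OF sS] q0]] Dv_snd_scaleR[OF diff[OF s1 q0]]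
      Dv_inner[OF diff[OF smooth_P q0] diff[OF smooth_on_Dv[OF smooth_on_Dv[OF smooth_h]] q0]] Pv[OF q0]
    by simp
  also have "Dv S ?q = R ?q \<bullet> Dv h ?q + Dv R ?q \<bullet> h ?q"
    unfolding S_def by (rule Dv_inner[OF diff[OF smooth_R q0] diff[OF smooth_h q0]])
  finally show "2 * (Dv R ?q \<bullet> h ?q) + 3 * (R ?q \<bullet> Dv h ?q) + P ?q \<bullet> Dv (Dv (Dv h)) ?q = 6 * \<beta> ?q"
    by (simp add: \<gamma>_def)
qed

text \<open>All terms of the third-order identity are expressed by the fundamental forms.  On the edge
  \<open>P = c n\<close>, and \<open>R\<close> has the components \<open>- c N\<close> along \<open>h\<close> and \<open>- c M\<close> along
  \<open>g\<^sub>u\<close>; since \<open>h\<^sub>v\<close> is a combination of \<open>g\<^sub>u\<close> and \<open>h\<close>, linearity of the Hessian turns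
  \<open>R\<^sub>v\<close> into the same combination of \<open>P\<^sub>u\<close> and \<open>R\<close>.  What remains is
  \<open>2 c\<close> times the expression below equal to \<open>6 \<beta> \<noteq> 0\<close>.\<close>

lemma nondegenerate_axis:
  assumes u: "\<bar>u\<bar> < r"
  shows "Dv (tN1 g n) (u, 0) - tN1 g n (u, 0) * Dv (tG g) (u, 0)
    - 2 * tM g n (u, 0) * Dv (tF g) (u, 0) \<noteq> 0"
proof -
  let ?q = "(u, 0::real)"
  have q: "?q \<in> ball 0 r" using u by (simp del: mem_ball)
  define c where "c = P ?q \<bullet> n ?q"
  have Pc: "P ?q = c *\<^sub>R n ?q" unfolding c_def by (rule P_axis(1)[OF u])
  have Rh: "R ?q \<bullet> h ?q = - c * tN1 g n ?q"
    using P_h_higher_derivatives_axis(1)[OF u] hvv_n_axis[OF u] by (simp add: Pc)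
  have Rg: "R ?q \<bullet> Du g ?q = - c * tM g n ?q"
  proof -
    let ?k = "Du (\<lambda>q. b q ^ 5)"
    have sk: "smooth_on (ball 0 r) ?k" by (rule smooth_on_Du[OF smooth_b5])
    have "R ?q \<bullet> Du g ?q + P ?q \<bullet> Du h ?q = snd ?q ^ 3 * (5 * ?k ?q + snd ?q * Dv ?k ?q)"
    proof (rule axis_cancel[OF _ _ q])
      show "snd q *\<^sub>R (R q \<bullet> Du g q + P q \<bullet> Du h q) = snd q *\<^sub>R (snd q ^ 3 * (5 * ?k q + snd q * Dv ?k q))"
        if "q \<in> ball 0 r" for q
        using R_Du_g[OF that] by (simp add: algebra_simps eval_nat_numeral)
      show "smooth_on (ball 0 r) (\<lambda>q. R q \<bullet> Du g q + P q \<bullet> Du h q)"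
        "smooth_on (ball 0 r) (\<lambda>q. snd q ^ 3 * (5 * ?k q + snd q * Dv ?k q))"
        by (intro smP sk)+
    qed
    then show ?thesis using hu_n_eq[OF q] by (simp add: Pc inner_commute)
  qed
  have Puh: "Du P ?q \<bullet> h ?q = - c * tM g n ?q"
  proof -
    have "Du (\<lambda>q. P q \<bullet> h q) ?q = Du (\<lambda>q. snd q ^ Suc 2 * \<beta> q) ?q"
      by (rule Du_cong[OF open_ball q]) (use P_h in simp)
    then show ?thesis
      unfolding Du_snd_power_mult[OF diff[OF smooth_\<beta> q]] Du_inner[OF diff[OF smooth_P q] diff[OF smooth_h q]]
      using hu_n_eq[OF q] by (simp add: Pc inner_commute)
  qed
  have lin: "linear (frechet_derivative grad (at (g ?q)))"
    using q g_V by (intro linear_frechet[OF smooth_grad]) auto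
  have "Dv R ?q = Dv (tF g) ?q *\<^sub>R Du P ?q + (Dv (tG g) ?q / 2) *\<^sub>R R ?q"
    unfolding Rv_axis[OF u] hv_axis[OF u] Pu[OF q] R_eq[OF q] linear_add[OF lin] linear_scale[OF lin] ..
  then have Rvh: "Dv R ?q \<bullet> h ?q = - c * (Dv (tF g) ?q * tM g n ?q + Dv (tG g) ?q / 2 * tN1 g n ?q)"
    by (simp add: inner_add_left Puh Rh algebra_simps)
  have Rhv: "R ?q \<bullet> Dv h ?q = - c * (Dv (tF g) ?q * tM g n ?q + Dv (tG g) ?q / 2 * tN1 g n ?q)"
    unfolding hv_axis[OF u] by (simp add: inner_add_right Rg Rh algebra_simps)
  have "2 * c * (Dv (tN1 g n) ?q - tN1 g n ?q * Dv (tG g) ?q - 2 * tM g n ?q * Dv (tF g) ?q) = 6 * \<beta> ?q"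
    using P_h_higher_derivatives_axis(2)[OF u] unfolding Rvh Rhv by (simp add: Pc hvvv_n_axis[OF u] algebra_simps)
  then show ?thesis using \<beta>_axis[OF u] by auto
qed

end

section \<open>Principal curvatures and the focal surface\<close>

text \<open>The principal curvatures are the roots of the determinant of the pencil
  \<open>II - \<kappa> I\<close>.\<close>

lemma principal_curvature_equation:
  fixes E F G L M N \<kappa> :: real
  defines "D \<equiv> E * G - F^2"
  defines "H \<equiv> (E * N - 2 * F * M + G * L) / (2 * D)" and "K \<equiv> (L * N - M^2) / D"
  assumes D: "D \<noteq> 0" and nonneg: "H^2 - K \<ge> 0"
    and \<kappa>: "\<kappa> = H + sqrt (H^2 - K) \<or> \<kappa> = H - sqrt (H^2 - K)"
  shows "(L - \<kappa> * E) * (N - \<kappa> * G) = (M - \<kappa> * F) * (M - \<kappa> * F)"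
proof -
  have "(\<kappa> - H)^2 = H^2 - K" using \<kappa> nonneg by auto
  then have "D * (\<kappa>^2 - 2 * H * \<kappa> + K) = 0" by (simp add: power2_eq_square algebra_simps)
  moreover have "D * (2 * H) = E * N - 2 * F * M + G * L" and "D * K = L * N - M^2"
    using D by (simp_all add: H_def K_def)
  ultimately have "D * \<kappa>^2 - (E * N - 2 * F * M + G * L) * \<kappa> + (L * N - M^2) = 0"
    by (metis (no_types, opaque_lifting) distrib_left mult.assoc right_diff_distrib)
  then show ?thesis by (simp add: D_def power2_eq_square algebra_simps)
qed

text \<open>The algebra behind the theorem.  \<open>E\<close>, \<open>F\<close>, \<open>G\<close>, \<open>L'\<close>, \<open>M'\<close> are the
  fundamental forms of the focal surface at the origin, written in the orthonormal frame, and its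
  third coefficient \<open>N'\<close> is the literal \<open>0\<close>.  The number \<open>s\<close> is the length of the focal direction
  and \<open>d\<close> the \<open>u\<close>-derivative of its reciprocal; \<open>d\<close> drops out because the focal direction
  is normal to the focal surface.\<close>

lemma focal_mean_curvature_formula:
  fixes \<kappa> L M k\<^sub>s L\<^sub>u M\<^sub>u \<kappa>\<^sub>u \<rho> \<rho>\<^sub>u \<rho>\<^sub>v s d :: real
  assumes \<rho>: "\<kappa> * \<rho> = 1" and \<rho>\<^sub>u: "\<kappa> * \<rho>\<^sub>u = - \<kappa>\<^sub>u * \<rho>" and "\<rho>\<^sub>v \<noteq> 0"
    and s: "s > 0" "s^2 = M^2 + (L - \<kappa>)^2"
  defines "E \<equiv> (1 - \<rho> * L)^2 + (\<rho> * M)^2 + \<rho>\<^sub>u^2" and "F \<equiv> \<rho>\<^sub>u * \<rho>\<^sub>v" and "G \<equiv> \<rho>\<^sub>v^2"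
    and "L' \<equiv> - ((1 - \<rho> * L) * ((- M\<^sub>u - (L - \<kappa>) * k\<^sub>s) / s - d * M)
        - \<rho> * M * ((L\<^sub>u - \<kappa>\<^sub>u - M * k\<^sub>s) / s + d * (L - \<kappa>)) - \<rho>\<^sub>u * (\<kappa> * M / s))"
    and "M' \<equiv> \<rho>\<^sub>v * (\<kappa> * M / s)"
  shows "(E * 0 - 2 * F * M' + G * L') / (2 * (E * G - F^2)) =
    - (\<kappa> * (k\<^sub>s * (M^2 + (L - \<kappa>)^2) + M\<^sub>u * (L - \<kappa>) - M * L\<^sub>u))
      / (2 * (M^2 + (L - \<kappa>)^2) powr (3/2))"
proof -
  let ?B = "k\<^sub>s * s^2 + M\<^sub>u * (L - \<kappa>) - M * L\<^sub>u"
  have \<rho>0: "\<rho> \<noteq> 0" "\<kappa> \<noteq> 0" using \<rho> by auto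
  have \<rho>u: "\<rho>\<^sub>u * \<kappa> = - \<kappa>\<^sub>u * \<rho>" using \<rho>\<^sub>u by (simp add: mult.commute)
  have \<alpha>: "1 - \<rho> * L = \<rho> * (\<kappa> - L)" using \<rho> by (simp add: algebra_simps)
  have det: "E * G - F^2 = \<rho>\<^sub>v^2 * \<rho>^2 * s^2"
    unfolding E_def F_def G_def \<alpha> s(2) by (simp add: power2_eq_square algebra_simps)
  have L': "L' * s = - \<rho> * ((\<kappa> - L) * (- M\<^sub>u - (L - \<kappa>) * k\<^sub>s) - M * (L\<^sub>u - \<kappa>\<^sub>u - M * k\<^sub>s)) + \<rho>\<^sub>u * \<kappa> * M"
    unfolding L'_def \<alpha> using s(1) by (simp add: field_simps)
  have "(L' - 2 * \<rho>\<^sub>u * \<kappa> * M / s) * s = - \<rho> * ?B"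
  proof -
    have "(L' - 2 * \<rho>\<^sub>u * \<kappa> * M / s) * s = L' * s - 2 * (\<rho>\<^sub>u * \<kappa>) * M"
      using s(1) by (simp add: field_simps)
    then show ?thesis unfolding L' \<rho>u s(2) by (simp add: power2_eq_square algebra_simps)
  qed
  then have "L' - 2 * \<rho>\<^sub>u * \<kappa> * M / s = - \<rho> * ?B / s" using s(1) by (simp only: eq_divide_eq) simp
  moreover have "- 2 * F * M' + G * L' = \<rho>\<^sub>v^2 * (L' - 2 * \<rho>\<^sub>u * \<kappa> * M / s)"
    by (simp add: F_def G_def M'_def algebra_simps power2_eq_square)
  ultimately have num: "- 2 * F * M' + G * L' = - (\<rho>\<^sub>v^2 * \<rho> * ?B) / s" by simp
  have "(E * 0 - 2 * F * M' + G * L') / (2 * (E * G - F^2)) =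
      (- (\<rho>\<^sub>v^2 * \<rho> * ?B) / s) / (2 * (\<rho>\<^sub>v^2 * \<rho>^2 * s^2))"
    using num det by simp
  also have "\<dots> = - (\<kappa> * ?B) / (2 * s^3)"
    using \<rho>0 s(1) \<open>\<rho>\<^sub>v \<noteq> 0\<close> \<rho> by (simp add: divide_simps power2_eq_square power3_eq_cube)
  also have "s^3 = (s^2) powr (3/2)"
    using s(1) by (simp add: powr_powr flip: powr_numeral)
  finally show ?thesis unfolding s(2) .
qed

lemma differentiable_sqrt:
  fixes f :: "'a::real_normed_vector \<Rightarrow> real"
  assumes "f differentiable (at q)" "f q > 0"
  shows "(\<lambda>q. sqrt (f q)) differentiable (at q)"
proof -
  obtain D where "(f has_derivative D) (at q)" using assms(1) by (auto simp: differentiable_def)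
  from has_derivative_real_sqrt[OF assms(2) this] show ?thesis by (rule differentiableI)
qed

lemma differentiable_eventually_greater:
  fixes f :: "'a::real_normed_vector \<Rightarrow> real"
  assumes "f differentiable (at q)" "f q > c"
  shows "\<forall>\<^sub>F p in nhds q. f p > c"
  using differentiable_imp_continuous_within[OF assms(1)] assms(2)
  by (simp add: continuous_within tendsto_at_iff_tendsto_nhds order_tendstoD)

lemma
  assumes "\<forall>\<^sub>F p in nhds q. f p = g p"
  shows Du_eventually_cong: "Du f q = Du g q" and Dv_eventually_cong: "Dv f q = Dv g q"
  using assms Du_cong[of _ q f g] Dv_cong[of _ q f g] by (auto simp: eventually_nhds)

context pure_frontal
begin

lemma forms_axis:
  assumes "\<bar>u\<bar> < r"
  shows "tE g (u, 0) = 1" "tF g (u, 0) = 0" "tG g (u, 0) = 1"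
  using assms by (simp_all add: tE_def tF_def tG_def gu_gu_axis gu_h_axis hh_axis)

lemma forms_Du_axis:
  assumes u: "\<bar>u\<bar> < r"
  shows "Du (tE g) (u, 0) = 0" "Du (tF g) (u, 0) = 0" "Du (tG g) (u, 0) = 0"
proof -
  have q: "(u, 0) \<in> ball (0 :: real \<times> real) r" using u by (simp del: mem_ball)
  show "Du (tE g) (u, 0) = 0" "Du (tF g) (u, 0) = 0" "Du (tG g) (u, 0) = 0"
    using Du_axis_cong[OF diff[OF smooth_forms(1) q] differentiable_const u forms_axis(1)]
      Du_axis_cong[OF diff[OF smooth_forms(2) q] differentiable_const u forms_axis(2)]
      Du_axis_cong[OF diff[OF smooth_forms(3) q] differentiable_const u forms_axis(3)]
    by simp_all
qed

lemma nu_axis: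
  assumes u: "\<bar>u\<bar> < r"
  shows "Du n (u, 0) = - tL g n (u, 0) *\<^sub>R Du g (u, 0) - tM g n (u, 0) *\<^sub>R h (u, 0)"
proof -
  have q: "(u, 0) \<in> ball (0 :: real \<times> real) r" using u by (simp del: mem_ball)
  show ?thesis
    by (subst frame_expand[OF u, of "Du n (u, 0)"])
      (simp add: nu_n[OF q] tL_def tM_def inner_commute[of "Du n (u, 0)" "Du g (u, 0)"]
        inner_commute[of "Du n (u, 0)" "h (u, 0)"])
qed

text \<open>On the edge \<open>g\<^sub>u\<^sub>v\<close> and \<open>n\<^sub>u\<^sub>v\<close> vanish, so only \<open>h\<close> contributes.\<close>

lemma forms_Dv_axis:
  assumes u: "\<bar>u\<bar> < r"
  shows "Dv (tE g) (u, 0) = 0" "Dv (tL g n) (u, 0) = 0"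
    "Dv (tM g n) (u, 0) = tL g n (u, 0) * Dv (tF g) (u, 0) + tM g n (u, 0) * Dv (tG g) (u, 0) / 2"
proof -
  let ?q = "(u, 0::real)"
  have q: "?q \<in> ball 0 r" using u by (simp del: mem_ball)
  note gu = diff[OF smooth_on_Du[OF smooth_g] q] and nu = diff[OF smooth_on_Du[OF smooth_n] q]
  have nuv: "Dv (Du n) ?q = 0"
    using Dv_Du_commute[OF smooth_n q] Du_cong[OF open_ball q nv_eq]
      Du_snd_scaleR[OF diff[OF smooth_m q]] by simp
  have minus: "Dv (\<lambda>q. - f q) ?q = - Dv f ?q" if "f differentiable (at ?q)" for f :: "real \<times> real \<Rightarrow> real"
    using Dv_bounded_linear[OF bounded_linear_minus[OF bounded_linear_ident] that] .
  have s: "smooth_on (ball 0 r) (\<lambda>q. Du g q \<bullet> Du n q)" "smooth_on (ball 0 r) (\<lambda>q. h q \<bullet> Du n q)"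
    by (intro sm)+
  show "Dv (tE g) ?q = 0"
    unfolding tE_def[abs_def] Dv_inner[OF gu gu] guv_eq[OF q] by simp
  show "Dv (tL g n) ?q = 0"
    unfolding tL_def[abs_def] minus[OF diff[OF s(1) q]] Dv_inner[OF gu nu] nuv guv_eq[OF q] by simp
  show "Dv (tM g n) ?q = tL g n ?q * Dv (tF g) ?q + tM g n ?q * Dv (tG g) ?q / 2"
    unfolding tM_def[abs_def] minus[OF diff[OF s(2) q]] Dv_inner[OF diff[OF smooth_h q] nu] nuv
    unfolding tM_def[symmetric] nu_axis[OF u] hv_axis[OF u]
    using u by (simp add: inner_add_left inner_diff_right inner_commute[of "h ?q" "Du g ?q"]
        gu_gu_axis hh_axis gu_h_axis algebra_simps)
qed

text \<open>At the origin \<open>H\<^sup>2 - K = ((L - N) / 2)\<^sup>2 + M\<^sup>2 > 0\<close>, so nearby the square root in the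
  principal curvatures is that of a positive number.\<close>

lemma
  assumes r: "0 < r" and M: "tM g n 0 \<noteq> 0" and \<kappa>: "\<kappa> \<in> {kappa1 g n, kappa2 g n}"
  shows kappa_differentiable: "\<kappa> differentiable (at 0)"
    and kappa_equation: "\<forall>\<^sub>F q in nhds 0. (tL g n q - \<kappa> q * tE g q) * (tN1 g n q - \<kappa> q * tG g q)
      = (tM g n q - \<kappa> q * tF g q) * (tM g n q - \<kappa> q * tF g q)"
proof -
  have q: "0 \<in> ball (0 :: real \<times> real) r" using r by simp
  have axis: "tE g 0 = 1" "tF g 0 = 0" "tG g 0 = 1"
    using forms_axis[of 0] r by (simp_all add: zero_prod_def)
  note d = smooth_forms[THEN diff, OF q]
  define D where "D = (\<lambda>q. tE g q * tG g q - (tF g q)^2)"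
  define H where "H = mean_curvature g n"
  define K where "K = gauss_curvature g n"
  have D0: "D 0 = 1" and dD: "D differentiable (at 0)"
    unfolding D_def using axis d by (auto intro!: derivative_intros)
  have dH: "H differentiable (at 0)" and dK: "K differentiable (at 0)"
    unfolding H_def K_def mean_curvature_def[abs_def] gauss_curvature_def[abs_def]
    using d dD D0 unfolding D_def by (auto intro!: derivative_intros)
  have "(H 0)^2 - K 0 = ((tL g n 0 - tN1 g n 0) / 2)^2 + (tM g n 0)^2"
    by (simp add: H_def K_def mean_curvature_def gauss_curvature_def axis power2_eq_square field_simps)
  then have disc0: "(H 0)^2 - K 0 > 0" using M by (simp add: add_nonneg_pos)
  have ddisc: "(\<lambda>q. (H q)^2 - K q) differentiable (at 0)"
    using dH dK by (auto intro!: derivative_intros)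
  have \<kappa>': "\<kappa> = (\<lambda>q. H q + sqrt ((H q)^2 - K q)) \<or> \<kappa> = (\<lambda>q. H q - sqrt ((H q)^2 - K q))"
    using \<kappa> by (auto simp: kappa1_def[abs_def] kappa2_def[abs_def] H_def K_def)
  then show "\<kappa> differentiable (at 0)"
    using dH differentiable_sqrt[OF ddisc disc0] by (auto intro!: derivative_intros)
  have "\<forall>\<^sub>F q in nhds 0. (H q)^2 - K q > 0" "\<forall>\<^sub>F q in nhds 0. D q > 0"
    using differentiable_eventually_greater[OF ddisc disc0] differentiable_eventually_greater[OF dD, of 0] D0
    by auto
  then show "\<forall>\<^sub>F q in nhds 0. (tL g n q - \<kappa> q * tE g q) * (tN1 g n q - \<kappa> q * tG g q)
      = (tM g n q - \<kappa> q * tF g q) * (tM g n q - \<kappa> q * tF g q)"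
  proof eventually_elim
    case (elim q)
    then show ?case
      using \<kappa>' by (intro principal_curvature_equation)
        (auto simp: D_def H_def K_def mean_curvature_def gauss_curvature_def)
  qed
qed

text \<open>This is the regularity of the focal surface.  If \<open>\<kappa>\<^sub>v\<close> were zero, the \<open>v\<close>-derivative of
  the equation for \<open>\<kappa>\<close> would be \<open>L - \<kappa>\<close> times the nondegeneracy expression equal to zero,
  whereas \<open>(L - \<kappa>) (N - \<kappa>) = M\<^sup>2 \<noteq> 0\<close>.\<close>

lemma kappa_v_nonzero:
  assumes r: "0 < r" and M: "tM g n 0 \<noteq> 0" and \<kappa>: "\<kappa> \<in> {kappa1 g n, kappa2 g n}"
    and nondeg: "Dv (tN1 g n) 0 - tN1 g n 0 * Dv (tG g) 0 - 2 * tM g n 0 * Dv (tF g) 0 \<noteq> 0"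
  shows "Dv \<kappa> 0 \<noteq> 0"
proof
  assume \<kappa>v: "Dv \<kappa> 0 = 0"
  have q: "0 \<in> ball (0 :: real \<times> real) r" using r by simp
  note d = smooth_forms[THEN diff, OF q] and d\<kappa> = kappa_differentiable[OF r M \<kappa>]
  let ?L = "tL g n 0" and ?M = "tM g n 0" and ?N = "tN1 g n 0" and ?k = "\<kappa> 0"
  have axis: "tE g 0 = 1" "tF g 0 = 0" "tG g 0 = 1"
    using forms_axis[of 0] r by (simp_all add: zero_prod_def)
  have Dv0: "Dv (tE g) 0 = 0" "Dv (tL g n) 0 = 0"
    "Dv (tM g n) 0 = ?L * Dv (tF g) 0 + ?M * Dv (tG g) 0 / 2"
    using forms_Dv_axis[of 0] r by (simp_all add: zero_prod_def)
  have f: "(\<lambda>q. x q - \<kappa> q * y q) differentiable (at 0)"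
    and f': "Dv (\<lambda>q. x q - \<kappa> q * y q) 0 = Dv x 0 - \<kappa> 0 * Dv y 0"
    if "x differentiable (at 0)" "y differentiable (at 0)" for x y
  proof -
    have ky: "(\<lambda>q. \<kappa> q * y q) differentiable (at 0)" using d\<kappa> that by (auto intro!: derivative_intros)
    then show "(\<lambda>q. x q - \<kappa> q * y q) differentiable (at 0)" using that by (auto intro!: derivative_intros)
    show "Dv (\<lambda>q. x q - \<kappa> q * y q) 0 = Dv x 0 - \<kappa> 0 * Dv y 0"
      unfolding Dv_diff[OF that(1) ky] Dv_mult[OF d\<kappa> that(2)] by (simp add: \<kappa>v)
  qed
  have eq0: "(?L - ?k) * (?N - ?k) = ?M * ?M"
    using eventually_nhds_x_imp_x[OF kappa_equation[OF r M \<kappa>]] by (simp add: axis)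
  have "Dv (\<lambda>q. (tL g n q - \<kappa> q * tE g q) * (tN1 g n q - \<kappa> q * tG g q)) 0
      = Dv (\<lambda>q. (tM g n q - \<kappa> q * tF g q) * (tM g n q - \<kappa> q * tF g q)) 0"
    by (rule Dv_eventually_cong[OF kappa_equation[OF r M \<kappa>]])
  then have "(?L - ?k) * (Dv (tN1 g n) 0 - ?k * Dv (tG g) 0)
      = 2 * ?M * (?L * Dv (tF g) 0 + ?M * Dv (tG g) 0 / 2 - ?k * Dv (tF g) 0)"
    unfolding Dv_mult[OF f[OF d(4,1)] f[OF d(6,3)]] Dv_mult[OF f[OF d(5,2)] f[OF d(5,2)]]
      f'[OF d(4,1)] f'[OF d(6,3)] f'[OF d(5,2)]
    by (simp add: axis Dv0 algebra_simps)
  also have "\<dots> = 2 * ?M * (?L - ?k) * Dv (tF g) 0 + ?M * ?M * Dv (tG g) 0"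
    by (simp add: algebra_simps)
  also have "\<dots> = (?L - ?k) * (2 * ?M * Dv (tF g) 0 + (?N - ?k) * Dv (tG g) 0)"
    unfolding eq0[symmetric] by (simp add: algebra_simps)
  finally have "(?L - ?k) * (Dv (tN1 g n) 0 - ?N * Dv (tG g) 0 - 2 * ?M * Dv (tF g) 0) = 0"
    by (simp add: algebra_simps)
  moreover have "?L - ?k \<noteq> 0" using eq0 M by auto
  ultimately show False using nondeg by simp
qed

text \<open>The derivatives at the origin of the focal surface and of its unit normal are computed in the
  orthonormal frame \<open>g\<^sub>u, h, n\<close> and inserted into \<open>focal_mean_curvature_formula\<close>.\<close>

lemma focal_mean_curvature:
  assumes r: "0 < r" and M: "tM g n 0 \<noteq> 0" and \<kappa>: "\<kappa> \<in> {kappa1 g n, kappa2 g n}"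
    and nondeg: "Dv (tN1 g n) 0 - tN1 g n 0 * Dv (tG g) 0 - 2 * tM g n 0 * Dv (tF g) 0 \<noteq> 0"
    and \<kappa>_nz: "\<forall>\<^sub>F q in nhds 0. \<kappa> q \<noteq> 0"
  shows "surface_mean_curvature (focal_surface g n \<kappa>) (focal_normal g n \<kappa>) 0 =
    - (\<kappa> 0 * (Du (Du g) 0 \<bullet> h 0 * ((tM g n 0)^2 + (tL g n 0 - \<kappa> 0)^2)
       + Du (tM g n) 0 * (tL g n 0 - \<kappa> 0) - tM g n 0 * Du (tL g n) 0))
      / (2 * ((tM g n 0)^2 + (tL g n 0 - \<kappa> 0)^2) powr (3/2))"
proof -
  have q: "0 \<in> ball (0 :: real \<times> real) r" using r by simp
  note d = smooth_forms[THEN diff, OF q] and d\<kappa> = kappa_differentiable[OF r M \<kappa>]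
  note dg = diff[OF smooth_g q] diff[OF smooth_on_Du[OF smooth_g] q]
    and dn = diff[OF smooth_n q] and dh = diff[OF smooth_h q]
  let ?a = "Du g 0" and ?b = "h 0" and ?c = "n 0"
  let ?L = "tL g n 0" and ?M = "tM g n 0" and ?k = "\<kappa> 0" and ?ks = "Du (Du g) 0 \<bullet> h 0"
  have axis: "tE g 0 = 1" "tF g 0 = 0" "tG g 0 = 1" "Du (tE g) 0 = 0" "Du (tF g) 0 = 0" "Du (tG g) 0 = 0"
    using forms_axis[of 0] forms_Du_axis[of 0] r by (simp_all add: zero_prod_def)
  have frame: "?a \<bullet> ?a = 1" "?b \<bullet> ?b = 1" "?c \<bullet> ?c = 1" "?a \<bullet> ?b = 0" "?b \<bullet> ?a = 0"
      "?a \<bullet> ?c = 0" "?c \<bullet> ?a = 0" "?b \<bullet> ?c = 0" "?c \<bullet> ?b = 0"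
    using axis n_n[OF q] gu_n[OF q] h_n[OF q] by (simp_all add: tE_def tF_def tG_def inner_commute)
  have nu: "Du n 0 = - ?L *\<^sub>R ?a - ?M *\<^sub>R ?b" and nv: "Dv n 0 = 0" and gv: "Dv g 0 = 0"
    using nu_axis[of 0] nv_axis[of 0] gv_axis[of 0] r by (simp_all add: zero_prod_def)
  have guu: "?a \<bullet> Du (Du g) 0 = 0" and hu: "?a \<bullet> Du h 0 = - ?ks" "?b \<bullet> Du h 0 = 0"
    using axis(4-6) Du_inner[OF dg(2) dg(2)] Du_inner[OF dg(2) dh] Du_inner[OF dh dh]
    by (simp_all add: tE_def[abs_def] tF_def[abs_def] tG_def[abs_def] inner_commute)

  define \<rho> where "\<rho> = (\<lambda>q. 1 / \<kappa> q)"
  have k0: "?k \<noteq> 0" using eventually_nhds_x_imp_x[OF \<kappa>_nz] .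
  have d\<rho>: "\<rho> differentiable (at 0)" unfolding \<rho>_def using d\<kappa> k0 by (auto intro!: derivative_intros)
  have \<kappa>\<rho>: "\<forall>\<^sub>F q in nhds 0. \<kappa> q * \<rho> q = 1"
    using \<kappa>_nz by eventually_elim (simp add: \<rho>_def)
  have \<rho>0: "?k * \<rho> 0 = 1" using k0 by (simp add: \<rho>_def)
  have \<rho>u: "?k * Du \<rho> 0 = - Du \<kappa> 0 * \<rho> 0" and \<rho>v: "?k * Dv \<rho> 0 = - Dv \<kappa> 0 * \<rho> 0"
    using Du_eventually_cong[OF \<kappa>\<rho>] Dv_eventually_cong[OF \<kappa>\<rho>] Du_mult[OF d\<kappa> d\<rho>] Dv_mult[OF d\<kappa> d\<rho>]
    by simp_all
  have \<rho>v0: "Dv \<rho> 0 \<noteq> 0"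
    using \<rho>v \<rho>0 kappa_v_nonzero[OF r M \<kappa> nondeg] by auto

  have C: "focal_surface g n \<kappa> = (\<lambda>q. g q + \<rho> q *\<^sub>R n q)"
    by (simp add: focal_surface_def[abs_def] \<rho>_def)
  have d\<rho>n: "(\<lambda>q. \<rho> q *\<^sub>R n q) differentiable (at 0)"
    using has_derivative_scaleR[OF has_derivative_Du_Dv[OF d\<rho>] has_derivative_Du_Dv[OF dn]]
    by (rule differentiableI)
  have Cu: "Du (focal_surface g n \<kappa>) 0 = (1 - \<rho> 0 * ?L) *\<^sub>R ?a - (\<rho> 0 * ?M) *\<^sub>R ?b + Du \<rho> 0 *\<^sub>R ?c"
    unfolding C Du_add[OF dg(1) d\<rho>n] Du_scaleR[OF d\<rho> dn] nu by (simp add: algebra_simps)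
  have Cv: "Dv (focal_surface g n \<kappa>) 0 = Dv \<rho> 0 *\<^sub>R ?c"
    unfolding C Dv_add[OF dg(1) d\<rho>n] Dv_scaleR[OF d\<rho> dn] nv gv by simp

  define x1 where "x1 = (\<lambda>q. - (tM g n q - \<kappa> q * tF g q))"
  define x2 where "x2 = (\<lambda>q. tL g n q - \<kappa> q * tE g q)"
  define x where "x = focal_direction g n \<kappa>"
  have x: "x = (\<lambda>q. x1 q *\<^sub>R Du g q + x2 q *\<^sub>R h q)"
    by (simp add: x_def focal_direction_def[abs_def] x1_def x2_def)
  have dk: "(\<lambda>q. \<kappa> q * tF g q) differentiable (at 0)" "(\<lambda>q. \<kappa> q * tE g q) differentiable (at 0)"
    using d\<kappa> d by (auto intro!: derivative_intros)
  have dx12: "x1 differentiable (at 0)" "x2 differentiable (at 0)"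
    unfolding x1_def x2_def using d dk by (auto intro!: derivative_intros)
  have x1u: "Du x1 0 = - Du (tM g n) 0"
    using Du_bounded_linear[OF bounded_linear_minus[OF bounded_linear_ident], of "\<lambda>q. tM g n q - \<kappa> q * tF g q" 0]
      Du_diff[OF d(5) dk(1)] Du_mult[OF d\<kappa> d(2)] differentiable_diff[OF d(5) dk(1)] axis
    by (simp add: x1_def)
  have x2u: "Du x2 0 = Du (tL g n) 0 - Du \<kappa> 0"
    unfolding x2_def Du_diff[OF d(4) dk(2)] Du_mult[OF d\<kappa> d(1)] by (simp add: axis)
  note dx' = has_derivative_scaleR[OF has_derivative_Du_Dv[OF dx12(1)] has_derivative_Du_Dv[OF dg(2)]]
    has_derivative_scaleR[OF has_derivative_Du_Dv[OF dx12(2)] has_derivative_Du_Dv[OF dh]]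
  have dx: "x differentiable (at 0)"
    unfolding x by (rule differentiableI[OF has_derivative_add[OF dx']])
  have x0: "x 0 = - ?M *\<^sub>R ?a + (?L - ?k) *\<^sub>R ?b"
    by (simp add: x x1_def x2_def axis)
  have xu: "Du x 0 = - ?M *\<^sub>R Du (Du g) 0 - Du (tM g n) 0 *\<^sub>R ?a + (?L - ?k) *\<^sub>R Du h 0
      + (Du (tL g n) 0 - Du \<kappa> 0) *\<^sub>R ?b"
    unfolding x Du_add[OF differentiableI[OF dx'(1)] differentiableI[OF dx'(2)]]
      Du_scaleR[OF dx12(1) dg(2)] Du_scaleR[OF dx12(2) dh] x1u x2u
    by (simp add: x1_def x2_def axis)
  have xu_a: "?a \<bullet> Du x 0 = - Du (tM g n) 0 - (?L - ?k) * ?ks"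
    and xu_b: "?b \<bullet> Du x 0 = Du (tL g n) 0 - Du \<kappa> 0 - ?M * ?ks"
    unfolding xu by (simp_all add: inner_add_right inner_diff_right frame guu hu inner_commute[of ?b "Du (Du g) 0"])

  define s where "s = norm (x 0)"
  have s2: "s^2 = ?M^2 + (?L - ?k)^2"
    unfolding s_def power2_norm_eq_inner x0
    by (simp add: inner_add_left inner_add_right inner_diff_left inner_diff_right frame power2_eq_square)
  have "s^2 > 0" unfolding s2 using M by (simp add: add_pos_nonneg)
  then have s0: "s > 0" and x0_nz: "x 0 \<noteq> 0" unfolding s_def by auto

  \<comment> \<open>The components of the derivatives of the unit normal along \<open>n\<close> come from \<open>\<langle>e, n\<rangle> = 0\<close>.\<close>
  define \<sigma> where "\<sigma> = (\<lambda>q. 1 / norm (x q))"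
  have dnorm: "(\<lambda>q. norm (x q)) differentiable (at 0)"
    using differentiable_chain_at[OF dx differentiable_norm_at[OF x0_nz]] by (simp add: o_def)
  have d\<sigma>: "\<sigma> differentiable (at 0)"
    unfolding \<sigma>_def using dnorm x0_nz by (auto intro!: derivative_intros)
  define e where "e = focal_normal g n \<kappa>"
  have e: "e = (\<lambda>q. \<sigma> q *\<^sub>R x q)"
    by (simp add: e_def focal_normal_def[abs_def] x_def \<sigma>_def)
  have de: "e differentiable (at 0)"
    unfolding e using has_derivative_scaleR[OF has_derivative_Du_Dv[OF d\<sigma>] has_derivative_Du_Dv[OF dx]]
    by (rule differentiableI)
  have eu: "Du e 0 = (1 / s) *\<^sub>R Du x 0 + Du \<sigma> 0 *\<^sub>R x 0"
    unfolding e Du_scaleR[OF d\<sigma> dx] by (simp add: \<sigma>_def s_def)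
  have eu_a: "?a \<bullet> Du e 0 = (- Du (tM g n) 0 - (?L - ?k) * ?ks) / s - Du \<sigma> 0 * ?M"
    and eu_b: "?b \<bullet> Du e 0 = (Du (tL g n) 0 - Du \<kappa> 0 - ?M * ?ks) / s + Du \<sigma> 0 * (?L - ?k)"
    unfolding eu x0 by (simp_all add: inner_add_right inner_diff_right xu_a xu_b frame)
  have e_n: "e p \<bullet> n p = 0" if "p \<in> ball 0 r" for p
    using gu_n[OF that] h_n[OF that] by (simp add: e x inner_add_left)
  have eu_c: "?c \<bullet> Du e 0 = - (?k * ?M / s)"
  proof -
    have "Du e 0 \<bullet> ?c = - (e 0 \<bullet> Du n 0)"
      using Du_cong[OF open_ball q e_n] Du_inner[OF de dn] by simp
    also have "e 0 \<bullet> Du n 0 = (x 0 \<bullet> Du n 0) / s" by (simp add: e \<sigma>_def s_def)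
    also have "x 0 \<bullet> Du n 0 = ?k * ?M"
      unfolding nu x0
      by (simp add: inner_add_left inner_diff_left inner_diff_right frame algebra_simps)
    finally show ?thesis by (simp add: inner_commute)
  qed
  have ev_c: "?c \<bullet> Dv e 0 = 0"
    using Dv_cong[OF open_ball q e_n] Dv_inner[OF de dn] nv by (simp add: inner_commute)

  note formula = focal_mean_curvature_formula[OF \<rho>0 \<rho>u \<rho>v0 s0 s2,
      where k\<^sub>s = ?ks and M\<^sub>u = "Du (tM g n) 0" and L\<^sub>u = "Du (tL g n) 0" and d = "Du \<sigma> 0"]
  show ?thesis
    unfolding surface_mean_curvature_def Let_def e_def[symmetric] Cu Cv formula[symmetric]
    by (simp add: inner_add_left inner_add_right inner_diff_left inner_diff_right frame eu_a eu_b eu_c ev_c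
      power2_eq_square mult.commute[of "Dv \<rho> 0" "Du \<rho> 0"])
qed

end

section \<open>From germs to a neighbourhood of the origin\<close>

lemma diffeo_germD:
  assumes "diffeo_germ \<phi>"
  obtains U V \<psi> where "open U" "0 \<in> U" "open V" "\<phi> ` U = V" "smooth_on U \<phi>" "smooth_on V \<psi>"
    "\<And>q. q \<in> U \<Longrightarrow> \<psi> (\<phi> q) = q" "\<And>p. p \<in> V \<Longrightarrow> \<phi> (\<psi> p) = p" "\<psi> ` V = U" "\<phi> 0 = 0"
  using assms unfolding diffeo_germ_def homeomorphism_def by metis

lemma diffeo_derivative_injective:
  assumes "open U" "smooth_on U \<phi>" "smooth_on V \<psi>" "\<phi> ` U \<subseteq> V" "\<And>q. q \<in> U \<Longrightarrow> \<psi> (\<phi> q) = q" "q \<in> U"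
  shows "frechet_derivative \<psi> (at (\<phi> q)) (frechet_derivative \<phi> (at q) X) = X"
proof -
  have "(\<phi> has_derivative frechet_derivative \<phi> (at q)) (at q)"
    and "(\<psi> has_derivative frechet_derivative \<psi> (at (\<phi> q))) (at (\<phi> q))"
    using smooth_on_imp_differentiable[OF assms(2,6)] smooth_on_imp_differentiable[OF assms(3), of "\<phi> q"]
      assms(4,6) by (auto simp flip: frechet_derivative_works)
  from has_derivative_compose[OF this]
  have "((\<lambda>q. q) has_derivative (\<lambda>X. frechet_derivative \<psi> (at (\<phi> q)) (frechet_derivative \<phi> (at q) X))) (at q)"
    by (rule has_derivative_transform_within_open[OF _ assms(1,6,5)])
  from has_derivative_unique[OF this has_derivative_ident] show ?thesis by metis
qed

lemma eventually_nhds_continuous: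
  assumes "isCont \<phi> a" "\<forall>\<^sub>F p in nhds (\<phi> a). Q p"
  shows "\<forall>\<^sub>F q in nhds a. Q (\<phi> q)"
proof -
  have "(\<phi> \<longlongrightarrow> \<phi> a) (nhds a)"
    using assms(1) by (simp add: isCont_def tendsto_at_iff_tendsto_nhds)
  then show ?thesis using assms(2) by (simp add: filterlim_iff)
qed

lemma eventually_nhds_ball:
  fixes Q :: "'a::real_normed_vector \<Rightarrow> bool"
  assumes "\<forall>\<^sub>F q in nhds 0. Q q"
  shows "\<exists>r>0. \<forall>q\<in>ball 0 r. Q q"
  using assms unfolding eventually_nhds_metric by (metis dist_commute mem_ball)

lemma eventually_nhds_axis:
  "\<forall>\<^sub>F u in nhds (0::real). Q u \<Longrightarrow> \<exists>r>0. \<forall>u. \<bar>u\<bar> < r \<longrightarrow> Q u"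
  by (auto simp: eventually_nhds_metric dist_real_def)

lemma smooth_germ_compose_diffeo:
  assumes "smooth_germ f" "diffeo_germ \<phi>"
  shows "smooth_germ (f \<circ> \<phi>)"
proof -
  obtain W where W: "open W" "0 \<in> W" "smooth_on W f" using assms(1) unfolding smooth_germ_def by blast
  obtain U V \<psi> where U: "open U" "0 \<in> U" "smooth_on U \<phi>" "\<phi> 0 = 0"
    by (rule diffeo_germD[OF assms(2)]) metis
  have "open (U \<inter> \<phi> -` W)"
    using U(1) W(1) smooth_on_imp_continuous_on[OF U(3)] by (metis continuous_on_open_vimage inf_commute)
  moreover have "smooth_on (U \<inter> \<phi> -` W) (\<lambda>q. f (\<phi> q))"
    by (rule smooth_on_compose[OF calculation W(1) _ W(3)]) (use smooth_on_subset[OF U(3)] in auto)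
  ultimately show ?thesis
    using U W unfolding smooth_germ_def o_def by (intro exI[of _ "U \<inter> \<phi> -` W"]) auto
qed

lemma frontal_with_normal_compose_diffeo:
  assumes f: "frontal_with_normal f \<nu>" and \<phi>: "diffeo_germ \<phi>"
  shows "frontal_with_normal (f \<circ> \<phi>) (\<nu> \<circ> \<phi>)"
proof -
  obtain W where W: "open W" "0 \<in> W" "smooth_on W f"
    using f unfolding frontal_with_normal_def smooth_germ_def by blast
  obtain U where U: "open U" "0 \<in> U" "smooth_on U \<phi>" "\<phi> 0 = 0"
    by (rule diffeo_germD[OF \<phi>]) metis
  have d\<phi>: "\<phi> differentiable (at q)" if "q \<in> U" for q
    using smooth_on_imp_differentiable[OF U(3) that] .
  have cont: "isCont \<phi> 0"
    using differentiable_imp_continuous_within[OF d\<phi>[OF U(2)]] .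
  have "\<forall>\<^sub>F p in nhds 0. p \<in> W" using W by (simp add: eventually_nhds_in_open)
  moreover have "\<forall>\<^sub>F p in nhds 0. norm (\<nu> p) = 1 \<and> (\<forall>X. frechet_derivative f (at p) X \<bullet> \<nu> p = 0)"
    using f unfolding frontal_with_normal_def by blast
  ultimately have "\<forall>\<^sub>F p in nhds (\<phi> 0). p \<in> W \<and> norm (\<nu> p) = 1 \<and> (\<forall>X. frechet_derivative f (at p) X \<bullet> \<nu> p = 0)"
    unfolding U(4) by (rule eventually_conj)
  from eventually_nhds_continuous[OF cont this] eventually_nhds_in_open[OF U(1,2)]
  have "\<forall>\<^sub>F q in nhds 0. norm ((\<nu> \<circ> \<phi>) q) = 1 \<and> (\<forall>X. frechet_derivative (f \<circ> \<phi>) (at q) X \<bullet> (\<nu> \<circ> \<phi>) q = 0)"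
  proof eventually_elim
    case (elim q)
    have "frechet_derivative (f \<circ> \<phi>) (at q) = frechet_derivative f (at (\<phi> q)) \<circ> frechet_derivative \<phi> (at q)"
      using elim smooth_on_imp_differentiable[OF W(3)] d\<phi> by (intro frechet_derivative_compose) auto
    then show ?case using elim by (simp del: split_paired_All)
  qed
  then show ?thesis
    using f smooth_germ_compose_diffeo[OF _ \<phi>] U(4) unfolding frontal_with_normal_def by auto
qed

lemma adapted_frontal_near_0:
  assumes frontal: "frontal_with_normal g n" and adapted: "adapted g n"
  obtains r where "0 < r" "adapted_frontal r g n"
proof -
  obtain U where U: "open U" "0 \<in> U" "smooth_on U g"
    using frontal unfolding frontal_with_normal_def smooth_germ_def by blast
  obtain V where V: "open V" "0 \<in> V" "smooth_on V n"
    using frontal unfolding frontal_with_normal_def smooth_germ_def by blast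
  have "\<forall>\<^sub>F q in nhds 0. norm (n q) = 1 \<and> (\<forall>X. frechet_derivative g (at q) X \<bullet> n q = 0)"
    using frontal unfolding frontal_with_normal_def by (elim conjE)
  moreover have "\<forall>\<^sub>F q in nhds 0. q \<in> singular_set g \<longleftrightarrow> snd q = 0"
    and "\<forall>\<^sub>F q in nhds 0. q \<in> singular_set g \<longrightarrow> Dv g q = 0"
    using adapted unfolding adapted_def by blast+
  moreover have "\<forall>\<^sub>F q in nhds 0. q \<in> U" "\<forall>\<^sub>F q in nhds 0. q \<in> V"
    by (intro eventually_nhds_in_open U V)+
  ultimately have "\<forall>\<^sub>F q in nhds 0. q \<in> U \<and> q \<in> V \<and> (norm (n q) = 1 \<and> (\<forall>X. frechet_derivative g (at q) X \<bullet> n q = 0))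
      \<and> (q \<in> singular_set g \<longleftrightarrow> snd q = 0) \<and> (q \<in> singular_set g \<longrightarrow> Dv g q = 0)"
    by eventually_elim blast
  from eventually_nhds_ball[OF this] obtain r1 where r1: "r1 > 0" "\<forall>q\<in>ball 0 r1. q \<in> U \<and> q \<in> V
      \<and> (norm (n q) = 1 \<and> (\<forall>X. frechet_derivative g (at q) X \<bullet> n q = 0))
      \<and> (q \<in> singular_set g \<longleftrightarrow> snd q = 0) \<and> (q \<in> singular_set g \<longrightarrow> Dv g q = 0)"
    by blast
  note r1 = r1(1) bspec[OF r1(2)]
  obtain r2 where r2: "r2 > 0" "\<And>u. \<bar>u\<bar> < r2 \<Longrightarrow>
      norm (Du g (u, 0)) = 1 \<and> norm (Dv (Dv g) (u, 0)) = 1 \<and> Du g (u, 0) \<bullet> Dv (Dv g) (u, 0) = 0"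
    using adapted unfolding adapted_def by (auto dest!: eventually_nhds_axis)
  define r where "r = min r1 r2"
  have ball: "q \<in> ball 0 r1" if "q \<in> ball 0 r" for q :: "real \<times> real"
    using that by (simp add: r_def)
  have "adapted_frontal r g n"
  proof
    show "smooth_on (ball 0 r) g" "smooth_on (ball 0 r) n"
      using smooth_on_subset[OF U(3)] smooth_on_subset[OF V(3)] r1(2) ball by blast+
    show "n q \<bullet> n q = 1" "Du g q \<bullet> n q = 0" "Dv g q \<bullet> n q = 0" if "q \<in> ball 0 r" for q
      using r1(2)[OF ball[OF that]] by (auto simp: Du_def Dv_def dot_square_norm)
    show "Dv g (u, 0) = 0" if "\<bar>u\<bar> < r" for u
      using r1(2)[of "(u, 0)"] that by (simp add: r_def del: mem_ball)
    show "Du g (u, 0) \<bullet> Du g (u, 0) = 1" "Dv (Dv g) (u, 0) \<bullet> Dv (Dv g) (u, 0) = 1"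
      "Du g (u, 0) \<bullet> Dv (Dv g) (u, 0) = 0" if "\<bar>u\<bar> < r" for u
      using r2(2)[of u] that by (simp_all add: r_def dot_square_norm)
  qed
  then show ?thesis using that[of r] r1(1) r2(1) by (simp add: r_def)
qed

text \<open>The coordinate changes of the normal form are only defined near the origin, so the ball has to
  be shrunk.\<close>

lemma adapted_frontal_subset:
  assumes "adapted_frontal r g n" "r' \<le> r"
  shows "adapted_frontal r' g n"
proof -
  interpret adapted_frontal r g n by fact
  have sub: "ball 0 r' \<subseteq> ball (0 :: real \<times> real) r" using assms(2) by auto
  show ?thesis
    using assms(2) sub smooth_on_subset[OF smooth_g sub] smooth_on_subset[OF smooth_n sub]
    by unfold_locales (auto intro!: n_n gu_n gv_n gv_axis gu_gu_axis gvv_gvv_axis gu_gvv_axis simp del: mem_ball)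
qed

text \<open>Let \<open>\<Phi>\<close> and \<open>W\<close> be the coordinate changes with \<open>\<Phi> \<circ> g = (W\<^sub>1, W\<^sub>2\<^sup>2, W\<^sub>2\<^sup>5)\<close>,
  and take \<open>y = W\<^sub>2\<close> and \<open>\<psi> = \<Phi>\<^sub>3\<close>.  On the axis \<open>g\<^sub>v = 0\<close>, so the \<open>v\<close>-derivatives of
  \<open>W\<^sub>1\<close> and \<open>y\<^sup>2\<close> vanish there; as \<open>W\<close> is a diffeomorphism, \<open>y\<^sub>v\<close> cannot vanish as
  well, and \<open>2 y y\<^sub>v = 0\<close> leaves \<open>y = 0\<close>.\<close>

lemma cuspidal_edge_quintic_contact:
  assumes cusp: "A_equivalent f (\<lambda>(u, v). vector [u, v^2, v^5])" and \<phi>: "diffeo_germ \<phi>"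
    and f0: "f 0 = 0" and r0: "0 < r0" and fr: "adapted_frontal r0 (f \<circ> \<phi>) n"
  obtains r V \<psi> y where "0 < r" "quintic_contact r (f \<circ> \<phi>) n V \<psi> y"
proof -
  let ?std = "\<lambda>(u, v). vector [u, v^2, v^5] :: real^3"
  obtain \<theta> \<Phi> where \<theta>: "diffeo_germ \<theta>" and \<Phi>: "diffeo_germ \<Phi>"
    and eq: "\<forall>\<^sub>F q in nhds 0. \<Phi> (f q) = ?std (\<theta> q)"
    using cusp unfolding A_equivalent_def by blast
  obtain U1 V1 \<phi>' where 1: "open U1" "0 \<in> U1" "\<phi> ` U1 = V1" "smooth_on U1 \<phi>" "smooth_on V1 \<phi>'"
    "\<And>q. q \<in> U1 \<Longrightarrow> \<phi>' (\<phi> q) = q" "\<phi> 0 = 0" by (rule diffeo_germD[OF \<phi>]) metis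
  obtain U2 V2 \<theta>' where 2: "open U2" "0 \<in> U2" "\<theta> ` U2 = V2" "smooth_on U2 \<theta>" "smooth_on V2 \<theta>'"
    "\<And>q. q \<in> U2 \<Longrightarrow> \<theta>' (\<theta> q) = q" by (rule diffeo_germD[OF \<theta>]) metis
  obtain U3 V3 \<Phi>' where 3: "open U3" "0 \<in> U3" "open V3" "\<Phi> ` U3 = V3" "smooth_on U3 \<Phi>" "smooth_on V3 \<Phi>'"
    "\<And>p. p \<in> V3 \<Longrightarrow> \<Phi> (\<Phi>' p) = p" "\<And>p. p \<in> U3 \<Longrightarrow> \<Phi>' (\<Phi> p) = p" "\<Phi>' ` V3 = U3"
    by (rule diffeo_germD[OF \<Phi>]) metis
  interpret f0: adapted_frontal r0 "f \<circ> \<phi>" n by (rule fr)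
  let ?g = "f \<circ> \<phi>"
  have c\<phi>: "isCont \<phi> 0" using differentiable_imp_continuous_within smooth_on_imp_differentiable[OF 1(4,2)] by blast
  have cg: "isCont ?g 0"
    by (rule differentiable_imp_continuous_within[OF smooth_on_imp_differentiable[OF f0.smooth_g]]) (use r0 in simp)
  have "\<forall>\<^sub>F q in nhds 0. q \<in> ball 0 r0" using r0 by (intro eventually_nhds_in_open) auto
  moreover have "\<forall>\<^sub>F q in nhds 0. q \<in> U1" using 1 by (intro eventually_nhds_in_open) auto
  moreover have "\<forall>\<^sub>F q in nhds 0. \<phi> q \<in> U2"
    by (rule eventually_nhds_continuous[OF c\<phi>]) (use 1 2 in \<open>auto intro: eventually_nhds_in_open\<close>)
  moreover have "\<forall>\<^sub>F q in nhds 0. ?g q \<in> U3"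
    by (rule eventually_nhds_continuous[OF cg]) (use 1 3 f0 in \<open>auto intro: eventually_nhds_in_open\<close>)
  moreover have "\<forall>\<^sub>F q in nhds 0. \<Phi> (f (\<phi> q)) = ?std (\<theta> (\<phi> q))"
    by (rule eventually_nhds_continuous[OF c\<phi>]) (use 1 eq in auto)
  ultimately have "\<forall>\<^sub>F q in nhds 0. q \<in> ball 0 r0 \<and> q \<in> U1 \<and> \<phi> q \<in> U2 \<and> ?g q \<in> U3
      \<and> \<Phi> (?g q) = ?std (\<theta> (\<phi> q))"
    by eventually_elim simp
  from eventually_nhds_ball[OF this] obtain r where r: "r > 0" and ball: "\<forall>q\<in>ball 0 r. q \<in> ball 0 r0 \<and> q \<in> U1 \<and> \<phi> q \<in> U2
      \<and> ?g q \<in> U3 \<and> \<Phi> (?g q) = ?std (\<theta> (\<phi> q))"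
    by blast
  note ball = bspec[OF ball]
  have "r \<le> r0"
  proof (rule ccontr)
    assume "\<not> r \<le> r0"
    then have "(r0, 0) \<in> ball (0 :: real \<times> real) r" using r0 by (simp del: mem_ball)
    from ball[OF this] have "(r0, 0) \<in> ball (0 :: real \<times> real) r0" by blast
    then show False by (simp del: mem_ball)
  qed
  interpret f1: adapted_frontal r ?g n by (rule adapted_frontal_subset[OF fr \<open>r \<le> r0\<close>])

  define W where "W = (\<lambda>q. \<theta> (\<phi> q))"
  have sW: "smooth_on (ball 0 r) W"
    unfolding W_def
    by (rule smooth_on_compose[OF open_ball 2(1) _ 2(4) smooth_on_subset[OF 1(4)]]) (use ball in auto)
  define y where "y = (\<lambda>q. snd (W q))"
  have sy: "smooth_on (ball 0 r) y"
    unfolding y_def by (rule smooth_on_bounded_linear[OF bounded_linear_snd open_ball sW])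
  have s1: "smooth_on (ball 0 r) (\<lambda>q. fst (W q))"
    by (rule smooth_on_bounded_linear[OF bounded_linear_fst open_ball sW])
  have comp: "\<Phi> (?g q) $ 1 = fst (W q)" "\<Phi> (?g q) $ 2 = y q ^ 2" "\<Phi> (?g q) $ 3 = y q ^ 5"
    if "q \<in> ball 0 r" for q
    using ball[OF that] by (auto simp: y_def W_def case_prod_beta)
  have s\<Phi>: "smooth_on U3 (\<lambda>p. \<Phi> p $ i)" for i
    by (rule smooth_on_bounded_linear[OF bounded_linear_vec_nth 3(1,5)])
  have zero: "Dv (\<lambda>q. \<Phi> (?g q) $ i) (u, 0) = 0" if u: "\<bar>u\<bar> < r" for i u
  proof -
    have q: "(u, 0::real) \<in> ball 0 r" using u by (simp del: mem_ball)
    have gq: "?g (u, 0) \<in> U3" using ball[OF q] by blast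
    have "linear (frechet_derivative (\<lambda>p. \<Phi> p $ i) (at (?g (u, 0))))"
      using smooth_on_imp_differentiable[OF s\<Phi> gq] frechet_derivative_works has_derivative_linear by blast
    then show ?thesis
      using Dv_compose[OF s\<Phi> gq f1.diff[OF f1.smooth_g q]] f1.gv_axis[OF u] by (simp add: linear_0)
  qed
  \<comment> \<open>Both coordinate changes of the source have a smooth left inverse, so no derivative vanishes.\<close>
  have W_nz: "Dv W (u, 0) \<noteq> 0" if u: "\<bar>u\<bar> < r" for u
  proof
    assume 0: "Dv W (u, 0) = 0"
    let ?q = "(u, 0::real)"
    have q: "?q \<in> ball 0 r" using u by (simp del: mem_ball)
    have q': "?q \<in> U1" "\<phi> ?q \<in> U2" using ball[OF q] by auto
    have d1: "\<phi> differentiable (at ?q)" by (rule smooth_on_imp_differentiable[OF 1(4) q'(1)])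
    have "frechet_derivative \<theta> (at (\<phi> ?q)) (Dv \<phi> ?q) = 0"
      using 0 Dv_compose[OF 2(4) q'(2) d1] by (simp add: W_def)
    moreover have "frechet_derivative \<theta>' (at (\<theta> (\<phi> ?q))) (frechet_derivative \<theta> (at (\<phi> ?q)) X) = X" for X
      by (rule diffeo_derivative_injective[OF 2(1,4,5) _ 2(6) q'(2)]) (use 2(3) in auto)
    moreover have "frechet_derivative \<phi>' (at (\<phi> ?q)) (frechet_derivative \<phi> (at ?q) X) = X" for X
      by (rule diffeo_derivative_injective[OF 1(1,4,5) _ 1(6) q'(1)]) (use 1(3) in auto)
    moreover have "linear (frechet_derivative \<theta>' (at (\<theta> (\<phi> ?q))))" "linear (frechet_derivative \<phi>' (at (\<phi> ?q)))"
      using smooth_on_imp_differentiable[OF 2(5)] smooth_on_imp_differentiable[OF 1(5)] 1(3) 2(3) q'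
        frechet_derivative_works has_derivative_linear by blast+
    ultimately have "(0, 1) = (0 :: real \<times> real)"
      unfolding Dv_def by (metis linear_0)
    then show False by (simp add: zero_prod_def)
  qed
  have dW: "W differentiable (at (u, 0))" if "\<bar>u\<bar> < r" for u
    by (rule f1.diff[OF sW]) (use that in \<open>simp del: mem_ball\<close>)
  have yv: "Dv y (u, 0) \<noteq> 0" and y0: "y (u, 0) = 0" if u: "\<bar>u\<bar> < r" for u
  proof -
    let ?q = "(u, 0::real)"
    have q: "?q \<in> ball 0 r" using u by (simp del: mem_ball)
    have "fst (Dv W ?q) = Dv (\<lambda>q. fst (W q)) ?q"
      by (rule Dv_bounded_linear[OF bounded_linear_fst dW[OF u], symmetric])
    also have "\<dots> = 0"
      using Dv_cong[OF open_ball q comp(1)] zero[OF u, of 1] by simp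
    finally have "snd (Dv W ?q) \<noteq> 0" using W_nz[OF u] by (simp add: prod_eq_iff)
    then show 1: "Dv y ?q \<noteq> 0"
      unfolding y_def Dv_bounded_linear[OF bounded_linear_snd dW[OF u]] .
    have "Dv (\<lambda>q. y q * y q) ?q = 0"
      using Dv_cong[OF open_ball q comp(2)] zero[OF u, of 2] by (simp add: power2_eq_square)
    then show "y ?q = 0" using 1 Dv_mult[OF f1.diff[OF sy q] f1.diff[OF sy q]] by simp
  qed
  have "quintic_contact r ?g n U3 (\<lambda>p. \<Phi> p $ 3) y"
  proof unfold_locales
    show "frechet_derivative (\<lambda>p. \<Phi> p $ 3) (at (?g (u, 0))) \<noteq> (\<lambda>_. 0)" if u: "\<bar>u\<bar> < r" for u
    proof
      assume 0: "frechet_derivative (\<lambda>p. \<Phi> p $ 3) (at (?g (u, 0))) = (\<lambda>_. 0)"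
      have q: "(u, 0::real) \<in> ball 0 r" using u by (simp del: mem_ball)
      define p where "p = ?g (u, 0)"
      have p: "p \<in> U3" using ball[OF q] by (simp add: p_def)
      then have p': "\<Phi> p \<in> V3" "\<Phi>' (\<Phi> p) = p" using 3 by auto
      \<comment> \<open>The differential of \<open>\<Phi>\<close> is onto, so none of its components is zero.\<close>
    have inv: "frechet_derivative \<Phi> (at p) (frechet_derivative \<Phi>' (at (\<Phi> p)) X) = X" for X
        using diffeo_derivative_injective[OF 3(3,6,5) _ 3(7) p'(1), of X] 3(9) p'(2) by simp
      have "(\<Phi> has_derivative frechet_derivative \<Phi> (at p)) (at p)"
        using smooth_on_imp_differentiable[OF 3(5) p] by (simp add: frechet_derivative_works)
      from frechet_derivative_at[OF bounded_linear.has_derivative[OF bounded_linear_vec_nth this, of 3]]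
      have "frechet_derivative \<Phi> (at p) X $ 3 = 0" for X
        using 0 by (metis p_def)
      from this[of "frechet_derivative \<Phi>' (at (\<Phi> p)) (axis 3 1)"] show False
        unfolding inv by simp
    qed
  qed (use 3 s\<Phi> ball sy comp(3) y0 yv in \<open>auto simp del: mem_ball\<close>)
  then show ?thesis using that r by blast
qed

theorem proposition4p15:
  fixes f \<nu> g n :: "real \<times> real \<Rightarrow> real^3"
    and \<phi> :: "real \<times> real \<Rightarrow> real \<times> real"
    and \<kappa> :: "real \<times> real \<Rightarrow> real"
    and \<kappa>\<^sub>s \<kappa>\<^sub>\<nu> \<kappa>\<^sub>t :: "real \<Rightarrow> real"
  assumes frontal: "frontal_with_normal f \<nu>"
    and cusp: "cuspidal_edge_5_2 f"
    and chart: "diffeo_germ \<phi>"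
    and g_def: "g = f \<circ> \<phi>" and n_def: "n = \<nu> \<circ> \<phi>"
    and adapted: "adapted g n"
    and ks_def: "\<kappa>\<^sub>s = singular_curvature g"
    and kn_def: "\<kappa>\<^sub>\<nu> = limiting_normal_curvature g n"
    and kt_def: "\<kappa>\<^sub>t = cuspidal_torsion g n"
    and kt_nonzero: "\<kappa>\<^sub>t 0 \<noteq> 0"
    and principal_nonzero: "\<forall>\<^sub>F q in nhds 0. kappa1 g n q \<noteq> 0 \<and> kappa2 g n q \<noteq> 0"
    and kj: "\<kappa> \<in> {kappa1 g n, kappa2 g n}"
  shows "surface_mean_curvature (focal_surface g n \<kappa>) (focal_normal g n \<kappa>) 0 =
    - (\<kappa> 0 * (\<kappa>\<^sub>s 0 * ((\<kappa>\<^sub>t 0)^2 + (\<kappa>\<^sub>\<nu> 0 - \<kappa> 0)^2)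
               + deriv \<kappa>\<^sub>t 0 * (\<kappa>\<^sub>\<nu> 0 - \<kappa> 0) - \<kappa>\<^sub>t 0 * deriv \<kappa>\<^sub>\<nu> 0))
      / (2 * ((\<kappa>\<^sub>t 0)^2 + (\<kappa>\<^sub>\<nu> 0 - \<kappa> 0)^2) powr (3/2))"
proof -
  have "frontal_with_normal g n"
    unfolding g_def n_def by (rule frontal_with_normal_compose_diffeo[OF frontal chart])
  from adapted_frontal_near_0[OF this adapted]
  obtain r0 where r0: "0 < r0" "adapted_frontal r0 (f \<circ> \<phi>) n" unfolding g_def by blast
  have "A_equivalent f (\<lambda>(u, v). vector [u, v^2, v^5])" "f 0 = 0"
    using cusp by (simp_all add: cuspidal_edge_5_2_def)
  from cuspidal_edge_quintic_contact[OF this(1) chart this(2) r0]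
  obtain r V \<psi> y where r: "0 < r" and "quintic_contact r g n V \<psi> y" unfolding g_def by blast
  then interpret quintic_contact r g n V \<psi> y by simp
  have q: "(0, 0) \<in> ball (0 :: real \<times> real) r" using r by (simp del: mem_ball)
  have vals: "\<kappa>\<^sub>s 0 = Du (Du g) 0 \<bullet> h 0" "\<kappa>\<^sub>\<nu> 0 = tL g n 0" "\<kappa>\<^sub>t 0 = tM g n 0"
    by (simp_all add: ks_def kn_def kt_def singular_curvature_def limiting_normal_curvature_def
        cuspidal_torsion_def zero_prod_def)
  have derivs: "deriv \<kappa>\<^sub>\<nu> 0 = Du (tL g n) 0" "deriv \<kappa>\<^sub>t 0 = Du (tM g n) 0"
    using deriv_axis[OF diff[OF smooth_forms(4) q]] deriv_axis[OF diff[OF smooth_forms(5) q]]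
    by (simp_all add: kn_def kt_def limiting_normal_curvature_def[abs_def] cuspidal_torsion_def[abs_def]
        zero_prod_def)
  have "\<forall>\<^sub>F q in nhds 0. \<kappa> q \<noteq> 0"
    using principal_nonzero kj by (auto elim: eventually_mono)
  from focal_mean_curvature[OF r _ kj _ this] show ?thesis
    using kt_nonzero nondegenerate_axis[of 0] r unfolding vals derivs by (simp add: zero_prod_def)
qed

end
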